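(* Let $h>0$, $\Omega=\{(x_1,x_2)\in\mathbb{R}^2: |x_2|<x_1<h\}$ (an isosceles right triangle) and $\Gamma=\{x_1=h,\ x_2\in[-h,h]\}$ (the hypotenuse). Then the exact constant $C_2(\Omega,\Gamma)$ is equal to $h^{\frac12}$.
   Context: For a bounded connected Lipschitz domain $\Omega\subset\mathbb{R}^d$ and a measurable part $\Gamma\subset\partial\Omega$ of positive $(d-1)$-dimensional measure, let $\widetilde H^1(\Omega,\Gamma)=\{w\in H^1(\Omega): \text{the mean value of (the trace of) } w \text{ on } \Gamma \text{ is zero}\}$. The norm in $L^2(\omega)$ is denoted $\|\cdot\|_{2,\omega}$. The exact (sharp) constant $C_2(\Omega,\Gamma)$ is the smallest constant $C$ such that $\|w\|_{2,\Gamma}\le C\|\nabla w\|_{2,\Omega}$ for all $w\in\widetilde H^1(\Omega,\Gamma)$. *)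

theory Defs
  imports "HOL-Analysis.Analysis"
begin

section \<open>Square-integrable functions\<close>

definition L2 :: "'a measure \<Rightarrow> ('a \<Rightarrow> 'b::euclidean_space) set" where
  "L2 M = {f \<in> borel_measurable M. integrable M (\<lambda>x. (norm (f x))\<^sup>2)}"

definition L2_norm :: "'a measure \<Rightarrow> ('a \<Rightarrow> 'b::euclidean_space) \<Rightarrow> real" where
  "L2_norm M f = sqrt (\<integral>x. (norm (f x))\<^sup>2 \<partial>M)"

text \<open>The Bochner integral of a non-integrable function is \<open>0\<close>, so membership in \<open>L2\<close> has to be
  demanded before \<open>L2_norm\<close> of a difference says anything.\<close>

definition L2_converges :: "'a measure \<Rightarrow> (nat \<Rightarrow> 'a \<Rightarrow> 'b::euclidean_space) \<Rightarrow> ('a \<Rightarrow> 'b) \<Rightarrow> bool" where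
  "L2_converges M F f \<longleftrightarrow>
     (\<forall>n. F n \<in> L2 M) \<and> f \<in> L2 M \<and> (\<lambda>n. L2_norm M (\<lambda>x. F n x - f x)) \<longlonglongrightarrow> 0"


section \<open>Smooth functions\<close>

primrec C_k :: "nat \<Rightarrow> ('a::euclidean_space \<Rightarrow> real) \<Rightarrow> bool" where
  "C_k 0 f \<longleftrightarrow> continuous_on UNIV f"
| "C_k (Suc k) f \<longleftrightarrow>
     (\<forall>x. f differentiable (at x)) \<and> (\<forall>b\<in>Basis. C_k k (\<lambda>x. frechet_derivative f (at x) b))"

definition smooth :: "('a::euclidean_space \<Rightarrow> real) \<Rightarrow> bool" where
  "smooth f \<longleftrightarrow> (\<forall>k. C_k k f)"

definition gradient :: "('a::euclidean_space \<Rightarrow> real) \<Rightarrow> 'a \<Rightarrow> 'a" where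
  "gradient f x = (\<Sum>b\<in>Basis. frechet_derivative f (at x) b *\<^sub>R b)"

definition test_function :: "'a::euclidean_space set \<Rightarrow> ('a \<Rightarrow> real) \<Rightarrow> bool" where
  "test_function \<Omega> \<phi> \<longleftrightarrow>
     smooth \<phi> \<and> compact (closure {x. \<phi> x \<noteq> 0}) \<and> closure {x. \<phi> x \<noteq> 0} \<subseteq> \<Omega>"


section \<open>The Sobolev space and traces\<close>

text \<open>Functions are defined on the whole type, but only their values on \<open>\<Omega>\<close> (up to null sets)
  matter. The weak gradient is a relation because it is unique only almost everywhere.\<close>

definition has_weak_gradient ::
    "'a::euclidean_space set \<Rightarrow> ('a \<Rightarrow> real) \<Rightarrow> ('a \<Rightarrow> 'a) \<Rightarrow> bool" where
  "has_weak_gradient \<Omega> w v \<longleftrightarrow>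
     (\<forall>\<phi>. test_function \<Omega> \<phi> \<longrightarrow>
        (\<forall>b\<in>Basis. (\<integral>x. w x * (gradient \<phi> x \<bullet> b) \<partial>lebesgue_on \<Omega>)
                    = - (\<integral>x. (v x \<bullet> b) * \<phi> x \<partial>lebesgue_on \<Omega>)))"

definition H1 :: "'a::euclidean_space set \<Rightarrow> ('a \<Rightarrow> real) set" where
  "H1 \<Omega> = {w \<in> L2 (lebesgue_on \<Omega>). \<exists>v \<in> L2 (lebesgue_on \<Omega>). has_weak_gradient \<Omega> w v}"

text \<open>A part \<open>\<Gamma>\<close> of the boundary enters through its surface measure \<open>\<sigma>\<close>, with \<open>space \<sigma> = \<Gamma>\<close>.
  The trace operator is the continuous extension of the restriction map \<open>\<phi> \<mapsto> \<phi>|\<Gamma>\<close> from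
  smooth functions on the closed domain to \<open>H1 \<Omega>\<close>; \<open>has_trace \<Omega> \<sigma> w g\<close> is the graph of this
  extension, \<open>g\<close> being determined up to \<open>\<sigma>\<close>-null sets. On a bounded Lipschitz domain smooth
  functions are dense in \<open>H1 \<Omega>\<close> and restriction to \<open>\<Gamma>\<close> is bounded, so every member of \<open>H1 \<Omega>\<close>
  has a trace there.\<close>

definition has_trace ::
    "'a::euclidean_space set \<Rightarrow> 'a measure \<Rightarrow> ('a \<Rightarrow> real) \<Rightarrow> ('a \<Rightarrow> real) \<Rightarrow> bool" where
  "has_trace \<Omega> \<sigma> w g \<longleftrightarrow>
     w \<in> H1 \<Omega> \<and>
     (\<exists>v \<phi>. has_weak_gradient \<Omega> w v \<and>
        (\<forall>n. smooth (\<phi> n)) \<and>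
        L2_converges (lebesgue_on \<Omega>) \<phi> w \<and>
        L2_converges (lebesgue_on \<Omega>) (\<lambda>n. gradient (\<phi> n)) v \<and>
        L2_converges \<sigma> \<phi> g)"

definition mean_value :: "'a measure \<Rightarrow> ('a \<Rightarrow> real) \<Rightarrow> real" where
  "mean_value \<sigma> g = (\<integral>x. g x \<partial>\<sigma>) / measure \<sigma> (space \<sigma>)"

definition H1_tilde :: "'a::euclidean_space set \<Rightarrow> 'a measure \<Rightarrow> ('a \<Rightarrow> real) set" where
  "H1_tilde \<Omega> \<sigma> = {w \<in> H1 \<Omega>. \<exists>g. has_trace \<Omega> \<sigma> w g \<and> mean_value \<sigma> g = 0}"


section \<open>The exact constant in the trace inequality\<close>

text \<open>Here \<open>g\<close> and \<open>v\<close> range over all representatives of the trace and of the weak gradient.\<close>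

definition trace_inequality :: "'a::euclidean_space set \<Rightarrow> 'a measure \<Rightarrow> real \<Rightarrow> bool" where
  "trace_inequality \<Omega> \<sigma> C \<longleftrightarrow>
     (\<forall>w \<in> H1_tilde \<Omega> \<sigma>. \<forall>g v.
        has_trace \<Omega> \<sigma> w g \<longrightarrow> v \<in> L2 (lebesgue_on \<Omega>) \<longrightarrow> has_weak_gradient \<Omega> w v \<longrightarrow>
        L2_norm \<sigma> g \<le> C * L2_norm (lebesgue_on \<Omega>) v)"

definition is_exact_constant_C2 :: "'a::euclidean_space set \<Rightarrow> 'a measure \<Rightarrow> real \<Rightarrow> bool" where
  "is_exact_constant_C2 \<Omega> \<sigma> C \<longleftrightarrow>
     trace_inequality \<Omega> \<sigma> C \<and> (\<forall>C'. trace_inequality \<Omega> \<sigma> C' \<longrightarrow> C \<le> C')"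


section \<open>The triangle and its hypotenuse\<close>

text \<open>The plane is \<open>real \<times> real\<close>, whose norm is Euclidean.\<close>

definition right_triangle :: "real \<Rightarrow> (real \<times> real) set" where
  "right_triangle h = {(x1, x2). \<bar>x2\<bar> < x1 \<and> x1 < h}"

definition hypotenuse :: "real \<Rightarrow> (real \<times> real) set" where
  "hypotenuse h = {(x1, x2). x1 = h \<and> x2 \<in> {-h..h}}"

text \<open>One-dimensional (arc length) measure on a part \<open>\<Gamma>\<close> of the line \<open>{a} \<times> \<real>\<close>: Lebesgue measure
  transported by the isometric parametrization \<open>t \<mapsto> (a, t)\<close>.\<close>

definition length_on_line :: "real \<Rightarrow> (real \<times> real) set \<Rightarrow> (real \<times> real) measure" where
  "length_on_line a \<Gamma> = embed_measure (lebesgue_on {t. (a, t) \<in> \<Gamma>}) (\<lambda>t. (a, t))"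

lemma space_length_on_line:
  assumes "\<Gamma> \<subseteq> {a} \<times> UNIV"
  shows "space (length_on_line a \<Gamma>) = \<Gamma>"
  using assms unfolding length_on_line_def space_embed_measure by auto

lemma emeasure_length_on_hypotenuse:
  assumes "h > 0"
  shows "emeasure (length_on_line h (hypotenuse h)) (hypotenuse h) = 2 * h"
proof -
  have *: "{t. (h, t) \<in> hypotenuse h} = {-h..h}" "hypotenuse h = (\<lambda>t. (h, t)) ` {-h..h}"
    by (auto simp: hypotenuse_def)
  have inj: "inj (\<lambda>t::real. (h, t))"
    by (auto simp: inj_on_def)
  have "{-h..h} \<in> sets (lebesgue_on {-h..h})"
    by (simp add: sets_restrict_space_iff)
  then have "emeasure (length_on_line h (hypotenuse h)) ((\<lambda>t. (h, t)) ` {-h..h})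
      = emeasure (lebesgue_on {-h..h}) {-h..h}"
    unfolding length_on_line_def *(1)
    by (intro emeasure_embed_measure_image[OF inj])
  also have "\<dots> = 2 * h"
    using assms by (simp add: emeasure_restrict_space)
  finally show ?thesis by (simp only: *(2))
qed

end

theory Submission
  imports Defs
begin

text \<open>
  Write \<open>T\<close> for the triangle \<open>\<bar>y\<bar> < x < h\<close> and \<open>\<Gamma>\<close> for its hypotenuse. The function \<open>x * y\<close> is harmonic,
  its normal derivative vanishes on the legs of \<open>T\<close>, and on \<open>\<Gamma>\<close> its normal derivative \<open>y\<close> is
  \<open>1 / h\<close> times its value \<open>h * y\<close>. So Green's formula gives \<open>\<parallel>w\<parallel>\<^sup>2 = h * \<parallel>\<nabla>w\<parallel>\<^sup>2\<close> for it, and it has mean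
  zero on \<open>\<Gamma>\<close>: the constant cannot be less than \<open>sqrt h\<close> (\<open>saddle_norms\<close>).

  That \<open>sqrt h\<close> suffices is shown for a smooth \<open>w\<close> by integrating \<open>\<nabla>w\<close> along broken lines
  (\<open>C1_trace_inequality\<close>). Split \<open>w\<close> into its even and odd parts in \<open>y\<close>; these
  are orthogonal on \<open>\<Gamma>\<close> and have orthogonal gradients on \<open>T\<close>, so each may be estimated by its own energy
  on the half \<open>0 < y < x < h\<close>. For \<open>0 \<le> t \<le> h\<close> let \<open>A t\<close> be the energy of the partial derivatives along
  the line from \<open>(t, 0)\<close> up to \<open>(t, t)\<close> and then right to \<open>(h, t)\<close>. As \<open>t\<close> varies, the horizontal and
  the vertical pieces each sweep the half triangle once, hence \<open>\<integral> A\<close> is the energy on it.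

  \<^item> The odd part vanishes at \<open>(t, 0)\<close>, and the line has length \<open>h\<close> whatever \<open>t\<close> is; Cauchy-Schwarz
    along the line gives \<open>w (h, t)\<^sup>2 \<le> h * A t\<close>.
  \<^item> For the even part and \<open>s \<le> t\<close> one walks from \<open>(h, t)\<close> to \<open>(t, t)\<close>, down to \<open>(t, s)\<close>, which are \<open>h - s\<close>
    units along line \<open>t\<close>, and back to \<open>(h, s)\<close>, which are \<open>h - t\<close> units along line \<open>s\<close>. So
    \<open>(w (h, t) - w (h, s))\<^sup>2 \<le> 2 * (h - s) * A t + 2 * (h - t) * A s\<close>. This is symmetric in \<open>s\<close> and \<open>t\<close>, and
    integrating over all \<open>s\<close> and \<open>t\<close> bounds the variance of \<open>w\<close> on \<open>\<Gamma>\<close> by \<open>h\<close> times the energy.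

  Both estimates pass to the limit in the \<open>L2\<close> convergences that define the trace. Since the weak gradient
  and the trace enter as relations, two uniqueness facts are needed. The weak gradient is unique almost
  everywhere (\<open>weak_gradient_unique\<close>): products of the functions \<open>exp (- 1 / (n * t))\<close> are test functions
  converging to the indicators of boxes. The mean of the trace depends only on \<open>w\<close> and its weak gradient
  (\<open>trace_mean_eq\<close>), because the divergence theorem for the field \<open>w (x, y) * (x, y)\<close>, which is tangential on
  the legs and has normal component \<open>h * w\<close> on \<open>\<Gamma>\<close>, expresses it by integrals over \<open>T\<close>.
\<close>

section \<open>Limits of square-integrable functions\<close>

lemma L2_D: "f \<in> L2 M \<Longrightarrow> f \<in> borel_measurable M" "f \<in> L2 M \<Longrightarrow> integrable M (\<lambda>x. (norm (f x))\<^sup>2)"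
  by (auto simp: L2_def)

lemma integrable_inner_L2:
  assumes "f \<in> L2 M" "g \<in> L2 M"
  shows "integrable M (\<lambda>x. f x \<bullet> g x)"
proof (rule Bochner_Integration.integrable_bound)
  show "integrable M (\<lambda>x. (norm (f x))\<^sup>2 + (norm (g x))\<^sup>2)"
    using assms by (auto intro: L2_D)
  show "(\<lambda>x. f x \<bullet> g x) \<in> borel_measurable M"
    using assms by (intro borel_measurable_inner L2_D(1))
  show "AE x in M. norm (f x \<bullet> g x) \<le> norm ((norm (f x))\<^sup>2 + (norm (g x))\<^sup>2)"
  proof (rule AE_I2)
    fix x
    have "0 \<le> (norm (f x) - norm (g x))\<^sup>2" by simp
    then have "norm (f x) * norm (g x) \<le> (norm (f x))\<^sup>2 + (norm (g x))\<^sup>2"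
      using mult_nonneg_nonneg[OF norm_ge_zero norm_ge_zero, of "f x" "g x"] unfolding power2_diff by linarith
    then show "norm (f x \<bullet> g x) \<le> norm ((norm (f x))\<^sup>2 + (norm (g x))\<^sup>2)"
      using Cauchy_Schwarz_ineq2[of "f x" "g x"] by simp
  qed
qed

lemma L2_diff:
  assumes "f \<in> L2 M" "g \<in> L2 M"
  shows "(\<lambda>x. f x - g x) \<in> L2 M"
proof -
  have "(norm (f x - g x))\<^sup>2 = (norm (f x))\<^sup>2 + (norm (g x))\<^sup>2 - 2 * (f x \<bullet> g x)" for x
    by (simp add: power2_norm_eq_inner inner_diff inner_commute)
  then show ?thesis
    using assms integrable_inner_L2[OF assms] by (auto simp: L2_def)
qed

text \<open>The quadratic form \<open>\<integral> (norm (s *\<^sub>R f x - t *\<^sub>R g x))\<^sup>2\<close> in \<open>(s, t)\<close> is nonnegative, so its discriminant is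
  not positive.\<close>

lemma L2_Cauchy_Schwarz:
  assumes f: "f \<in> L2 M" and g: "g \<in> L2 M"
  shows "\<bar>\<integral>x. f x \<bullet> g x \<partial>M\<bar> \<le> L2_norm M f * L2_norm M g"
proof -
  define F G I where "F = (\<integral>x. (norm (f x))\<^sup>2 \<partial>M)" and "G = (\<integral>x. (norm (g x))\<^sup>2 \<partial>M)"
    and "I = (\<integral>x. f x \<bullet> g x \<partial>M)"
  have quad: "0 \<le> F * s\<^sup>2 - 2 * s * t * I + G * t\<^sup>2" for s t
  proof -
    have "0 \<le> (\<integral>x. (norm (s *\<^sub>R f x - t *\<^sub>R g x))\<^sup>2 \<partial>M)" by simp
    also have "\<dots> = (\<integral>x. s\<^sup>2 * (norm (f x))\<^sup>2 - 2 * s * t * (f x \<bullet> g x) + t\<^sup>2 * (norm (g x))\<^sup>2 \<partial>M)"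
      unfolding power2_norm_eq_inner
      by (intro Bochner_Integration.integral_cong)
        (auto simp: inner_diff inner_commute power2_eq_square algebra_simps)
    also have "\<dots> = s\<^sup>2 * F - 2 * s * t * I + t\<^sup>2 * G"
      using L2_D(2)[OF f] L2_D(2)[OF g] integrable_inner_L2[OF f g] unfolding F_def G_def I_def by simp
    finally show ?thesis by (simp add: mult.commute)
  qed
  have FG: "0 \<le> F" "0 \<le> G" by (auto simp: F_def G_def)
  have "I\<^sup>2 \<le> F * G"
  proof (cases "F = 0")
    case True
    have "I = 0"
    proof (rule ccontr)
      assume "I \<noteq> 0"
      \<comment> \<open>For \<open>F = 0\<close> the form is affine in \<open>s\<close>; this \<open>s\<close> gives it the value \<open>-1\<close>.\<close>
      then have "2 * ((G + 1) / (2 * I)) * 1 * I = G + 1" by simp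
      then show False using quad[of "(G + 1) / (2 * I)" 1] True by simp
    qed
    then show ?thesis using FG by simp
  next
    case False
    have "0 \<le> F * (G * F - I\<^sup>2)" using quad[of I F] by (simp add: power2_eq_square algebra_simps)
    then show ?thesis using False FG by (simp add: zero_le_mult_iff mult.commute)
  qed
  then have "\<bar>I\<bar> \<le> sqrt (F * G)" using real_le_rsqrt[of "\<bar>I\<bar>"] by simp
  then show ?thesis unfolding I_def F_def G_def L2_norm_def by (simp add: real_sqrt_mult)
qed

lemma L2_converges_inner:
  assumes F: "L2_converges M F f" and q: "q \<in> L2 M"
  shows "(\<lambda>n. \<integral>x. q x \<bullet> F n x \<partial>M) \<longlonglongrightarrow> (\<integral>x. q x \<bullet> f x \<partial>M)"
proof -
  have L: "F n \<in> L2 M" "f \<in> L2 M" and lim: "(\<lambda>n. L2_norm M (\<lambda>x. F n x - f x)) \<longlonglongrightarrow> 0" for n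
    using F by (auto simp: L2_converges_def)
  have "(\<lambda>n. (\<integral>x. q x \<bullet> F n x \<partial>M) - (\<integral>x. q x \<bullet> f x \<partial>M)) \<longlonglongrightarrow> 0"
  proof (rule Lim_null_comparison)
    have "(\<integral>x. q x \<bullet> F n x \<partial>M) - (\<integral>x. q x \<bullet> f x \<partial>M) = (\<integral>x. q x \<bullet> (F n x - f x) \<partial>M)" for n
      using integrable_inner_L2[OF q L(1)[of n]] integrable_inner_L2[OF q L(2)] by (simp add: inner_diff_right)
    then show "\<forall>\<^sub>F n in sequentially. norm ((\<integral>x. q x \<bullet> F n x \<partial>M) - (\<integral>x. q x \<bullet> f x \<partial>M))
        \<le> L2_norm M q * L2_norm M (\<lambda>x. F n x - f x)"
      using L2_Cauchy_Schwarz[OF q L2_diff[OF L]] by simp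
    show "(\<lambda>n. L2_norm M q * L2_norm M (\<lambda>x. F n x - f x)) \<longlonglongrightarrow> 0"
      by (rule tendsto_mult_right_zero[OF lim])
  qed
  then show ?thesis by (simp add: LIM_zero_iff)
qed

text \<open>Expanding \<open>(norm (F n x - f x))\<^sup>2\<close> reduces the convergence of the norms to the convergence of the inner
  products with \<open>f\<close>.\<close>

lemma L2_converges_square:
  assumes F: "L2_converges M F f"
  shows "(\<lambda>n. \<integral>x. (norm (F n x))\<^sup>2 \<partial>M) \<longlonglongrightarrow> (\<integral>x. (norm (f x))\<^sup>2 \<partial>M)"
proof -
  have L: "F n \<in> L2 M" "f \<in> L2 M" and lim: "(\<lambda>n. L2_norm M (\<lambda>x. F n x - f x)) \<longlonglongrightarrow> 0" for n
    using F by (auto simp: L2_converges_def)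
  have sq: "(L2_norm M g)\<^sup>2 = (\<integral>x. (norm (g x))\<^sup>2 \<partial>M)" for g :: "'a \<Rightarrow> 'b"
    by (simp add: L2_norm_def)
  have "(\<integral>x. (norm (F n x))\<^sup>2 \<partial>M) =
      (L2_norm M (\<lambda>x. F n x - f x))\<^sup>2 + 2 * (\<integral>x. f x \<bullet> F n x \<partial>M) - (\<integral>x. (norm (f x))\<^sup>2 \<partial>M)" for n
  proof -
    have "(L2_norm M (\<lambda>x. F n x - f x))\<^sup>2 = (\<integral>x. (norm (F n x))\<^sup>2 - 2 * (f x \<bullet> F n x) + (norm (f x))\<^sup>2 \<partial>M)"
      unfolding sq by (intro Bochner_Integration.integral_cong)
        (auto simp: power2_norm_eq_inner inner_diff inner_commute)
    then show ?thesis
      using L2_D(2)[OF L(1)[of n]] L2_D(2)[OF L(2)] integrable_inner_L2[OF L(2) L(1)[of n]] by simp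
  qed
  moreover have "(\<lambda>n. (L2_norm M (\<lambda>x. F n x - f x))\<^sup>2 + 2 * (\<integral>x. f x \<bullet> F n x \<partial>M) - (\<integral>x. (norm (f x))\<^sup>2 \<partial>M))
      \<longlonglongrightarrow> 0\<^sup>2 + 2 * (\<integral>x. f x \<bullet> f x \<partial>M) - (\<integral>x. (norm (f x))\<^sup>2 \<partial>M)"
    by (intro tendsto_intros lim L2_converges_inner[OF F L(2)])
  ultimately show ?thesis by (simp add: power2_norm_eq_inner)
qed

lemma L2_converges_const: "f \<in> L2 M \<Longrightarrow> L2_converges M (\<lambda>n. f) f"
  by (simp add: L2_converges_def L2_norm_def)

lemma integrable_lborel_indicator_continuous:
  fixes P :: "'a::euclidean_space \<Rightarrow> real"
  assumes "continuous_on UNIV P" "S \<subseteq> cbox a b" "S \<in> sets borel"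
  shows "integrable lborel (\<lambda>z. indicator S z * P z)"
proof -
  have "set_integrable lborel (cbox a b) P"
    using assms(1) continuous_on_subset unfolding set_integrable_def
    by (intro borel_integrable_compact) (auto)
  then have "set_integrable lborel S P"
    using assms(2,3) by (auto intro: set_integrable_subset)
  then show ?thesis by (simp add: set_integrable_def)
qed

lemma integrable_continuous_bounded:
  fixes P :: "'a::euclidean_space \<Rightarrow> real"
  assumes "continuous_on UNIV P" "S \<subseteq> cbox a b" "S \<in> sets borel"
  shows "integrable (lebesgue_on S) P"
proof -
  have "integrable lebesgue (\<lambda>z. indicator S z * P z)"
    using integrable_lborel_indicator_continuous[OF assms]
    by (simp add: integrable_completion borel_measurable_integrable)
  then show ?thesis
    using assms(3) by (subst integrable_restrict_space) auto
qed

lemma continuous_L2: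
  fixes F :: "'a::euclidean_space \<Rightarrow> 'b::euclidean_space"
  assumes "continuous_on UNIV F" "S \<subseteq> cbox a b" "S \<in> sets borel"
  shows "F \<in> L2 (lebesgue_on S)"
proof -
  have "F \<in> borel_measurable lebesgue"
    using borel_measurable_continuous_onI[OF assms(1)] by (intro measurable_completion) simp
  then have "F \<in> borel_measurable (lebesgue_on S)"
    by (rule measurable_restrict_space1)
  moreover have "integrable (lebesgue_on S) (\<lambda>x. (norm (F x))\<^sup>2)"
    by (intro integrable_continuous_bounded[OF _ assms(2,3)] continuous_intros assms(1))
  ultimately show ?thesis by (simp add: L2_def)
qed


section \<open>Smooth functions\<close>

lemma C_k_SucI:
  assumes "\<And>x. (f has_derivative D x) (at x)" "\<And>b. b \<in> Basis \<Longrightarrow> C_k k (\<lambda>x. D x b)"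
  shows "C_k (Suc k) f"
proof -
  have "frechet_derivative f (at x) = D x" for x
    using frechet_derivative_at[OF assms(1)] by simp
  then show ?thesis using assms by (auto simp: differentiable_def)
qed

lemma C_k_Suc_has_derivative:
  "C_k (Suc k) f \<Longrightarrow> (f has_derivative frechet_derivative f (at x)) (at x)"
  by (simp add: frechet_derivative_works)

lemma C_k_Suc_imp: "C_k (Suc k) f \<Longrightarrow> C_k k f"
proof (induction k arbitrary: f)
  case 0
  then show ?case
    using differentiable_imp_continuous_on[of f UNIV] by (simp add: differentiable_on_def)
next
  case (Suc k)
  from Suc.prems have "(\<forall>x. f differentiable (at x)) \<and> (\<forall>b\<in>Basis. C_k (Suc k) (\<lambda>x. frechet_derivative f (at x) b))"
    unfolding C_k.simps(2)[of "Suc k"] .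
  then have "(\<forall>x. f differentiable (at x)) \<and> (\<forall>b\<in>Basis. C_k k (\<lambda>x. frechet_derivative f (at x) b))"
    using Suc.IH by blast
  then show ?case unfolding C_k.simps(2)[of k] .
qed

lemma C_k_const: "C_k k (\<lambda>x. c)"
proof (induction k arbitrary: c)
  case (Suc k)
  then show ?case by (intro C_k_SucI[of _ "\<lambda>x y. 0"]) (auto intro: derivative_eq_intros)
qed simp

lemma C_k_add: "C_k k f \<Longrightarrow> C_k k g \<Longrightarrow> C_k k (\<lambda>x. f x + g x)"
proof (induction k arbitrary: f g)
  case 0
  then show ?case by (auto intro: continuous_intros)
next
  case (Suc k)
  show ?case
  proof (rule C_k_SucI)
    show "((\<lambda>x. f x + g x) has_derivative (\<lambda>y. frechet_derivative f (at x) y + frechet_derivative g (at x) y)) (at x)" for x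
      using Suc.prems by (intro has_derivative_add C_k_Suc_has_derivative)
    show "C_k k (\<lambda>x. frechet_derivative f (at x) b + frechet_derivative g (at x) b)" if "b \<in> Basis" for b
      using Suc.prems that by (intro Suc.IH) auto
  qed
qed

lemma C_k_mult: "C_k k f \<Longrightarrow> C_k k g \<Longrightarrow> C_k k (\<lambda>x. f x * g x)"
proof (induction k arbitrary: f g)
  case 0
  then show ?case by (auto intro: continuous_intros)
next
  case (Suc k)
  show ?case
  proof (rule C_k_SucI)
    show "((\<lambda>x. f x * g x) has_derivative
        (\<lambda>y. f x * frechet_derivative g (at x) y + frechet_derivative f (at x) y * g x)) (at x)" for x
      using Suc.prems by (intro has_derivative_mult C_k_Suc_has_derivative)
    show "C_k k (\<lambda>x. f x * frechet_derivative g (at x) b + frechet_derivative f (at x) b * g x)"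
      if "b \<in> Basis" for b
    proof (intro C_k_add Suc.IH)
      show "C_k k f" "C_k k g"
        using Suc.prems by (blast intro: C_k_Suc_imp)+
      show "C_k k (\<lambda>x. frechet_derivative g (at x) b)" "C_k k (\<lambda>x. frechet_derivative f (at x) b)"
        using Suc.prems that by auto
    qed
  qed
qed

lemma smooth_mult: "smooth f \<Longrightarrow> smooth g \<Longrightarrow> smooth (\<lambda>x. f x * g x)"
  by (simp add: smooth_def C_k_mult)

lemma smooth_inner: "smooth (\<lambda>x::'a::euclidean_space. x \<bullet> v)"
  unfolding smooth_def
proof
  fix k
  show "C_k k (\<lambda>x. x \<bullet> v)"
  proof (cases k)
    case (Suc m)
    show ?thesis unfolding Suc
      by (rule C_k_SucI[where D = "\<lambda>x y. y \<bullet> v"]) (auto intro!: derivative_eq_intros C_k_const)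
  qed (auto intro: continuous_intros)
qed

lemma smooth_prod:
  assumes "finite I" "\<And>i. i \<in> I \<Longrightarrow> smooth (f i)"
  shows "smooth (\<lambda>x. \<Prod>i\<in>I. f i x)"
  using assms by (induction I rule: finite_induct) (auto simp: smooth_def C_k_const intro: C_k_mult)

lemma smooth_continuous: "smooth \<phi> \<Longrightarrow> continuous_on UNIV \<phi>"
  by (metis C_k.simps(1) smooth_def)

lemma smooth_has_derivative: "smooth \<phi> \<Longrightarrow> (\<phi> has_derivative frechet_derivative \<phi> (at x)) (at x)"
  by (rule C_k_Suc_has_derivative) (simp add: smooth_def del: C_k.simps)

lemma smooth_continuous_partial:
  assumes "smooth \<phi>" "b \<in> Basis"
  shows "continuous_on UNIV (\<lambda>x. frechet_derivative \<phi> (at x) b)"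
proof -
  have "C_k (Suc 0) \<phi>" using assms(1) unfolding smooth_def ..
  then show ?thesis using assms(2) by simp
qed

lemma continuous_gradient: "smooth \<phi> \<Longrightarrow> continuous_on UNIV (gradient \<phi>)"
  unfolding gradient_def by (intro continuous_intros smooth_continuous_partial)

lemma gradient_mult:
  assumes "smooth f" "smooth g"
  shows "gradient (\<lambda>x. f x * g x) z = f z *\<^sub>R gradient g z + g z *\<^sub>R gradient f z"
proof -
  have "((\<lambda>x. f x * g x) has_derivative
      (\<lambda>y. f z * frechet_derivative g (at z) y + frechet_derivative f (at z) y * g z)) (at z)"
    by (intro has_derivative_mult smooth_has_derivative assms)
  from frechet_derivative_at[OF this]
  have "frechet_derivative (\<lambda>x. f x * g x) (at z) =
      (\<lambda>y. f z * frechet_derivative g (at z) y + frechet_derivative f (at z) y * g z)" by simp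
  then show ?thesis
    by (simp add: gradient_def sum.distrib scaleR_sum_right algebra_simps)
qed


section \<open>Smooth approximations of the indicator of a box\<close>

text \<open>The derivatives of \<open>exp (- c / t)\<close> are products of this function with polynomials in \<open>1 / t\<close>. Carrying such
  a polynomial \<open>q\<close> as a parameter makes the family closed under differentiation.\<close>

definition flat_exp :: "real \<Rightarrow> real poly \<Rightarrow> real \<Rightarrow> real" where
  "flat_exp c q t = (if 0 < t then exp (- c / t) * poly q (1 / t) else 0)"

definition flat_exp_deriv :: "real \<Rightarrow> real poly \<Rightarrow> real poly" where
  "flat_exp_deriv c q = [:0, 0, 1:] * (smult c q - pderiv q)"

lemma exp_poly_tendsto_0:
  fixes c :: real
  assumes "0 < c"
  shows "((\<lambda>s. exp (- c * s) * poly q s) \<longlongrightarrow> 0) at_top"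
proof -
  have pow: "((\<lambda>s. exp (- c * s) * s ^ k) \<longlongrightarrow> 0) at_top" for k
  proof -
    have "filterlim (\<lambda>s. c * s) at_top at_top"
      using assms by (intro filterlim_tendsto_pos_mult_at_top[where c = c] filterlim_ident) auto
    \<comment> \<open>Scaling the variable by \<open>c\<close> reduces to \<open>x ^ k / exp x\<close>.\<close>
    then have "((\<lambda>s. (1 / c ^ k) * ((c * s) ^ k / exp (c * s))) \<longlongrightarrow> (1 / c ^ k) * 0) at_top"
      by (intro tendsto_intros filterlim_compose[OF tendsto_power_div_exp_0])
    moreover have "(1 / c ^ k) * ((c * s) ^ k / exp (c * s)) = exp (- c * s) * s ^ k" for s
      using assms by (simp add: power_mult_distrib exp_minus field_simps)
    ultimately show ?thesis by simp
  qed
  have "((\<lambda>s. \<Sum>i\<le>degree q. coeff q i * (exp (- c * s) * s ^ i)) \<longlongrightarrow> (\<Sum>i\<le>degree q. coeff q i * 0)) at_top"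
    by (intro tendsto_intros pow)
  then show ?thesis by (simp add: poly_altdef sum_distrib_left mult_ac)
qed

text \<open>Only \<open>t = 0\<close> is delicate; there the difference quotient from the right is, with \<open>s = 1 / t\<close>, the function
  \<open>exp (- c * s) * (s * poly q s)\<close> as \<open>s\<close> tends to infinity.\<close>

lemma flat_exp_has_derivative:
  assumes "0 < c"
  shows "(flat_exp c q has_real_derivative flat_exp c (flat_exp_deriv c q) t) (at t)"
proof -
  consider "0 < t" | "t < 0" | "t = 0" by linarith
  then show ?thesis
  proof cases
    case 1
    have "((\<lambda>t. exp (- c / t) * poly q (1 / t)) has_real_derivative flat_exp c (flat_exp_deriv c q) t) (at t)"
      using 1 by (auto intro!: derivative_eq_intros DERIV_chain2[OF poly_DERIV]
          simp: flat_exp_def flat_exp_deriv_def field_simps power2_eq_square)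
    then show ?thesis
      by (rule has_field_derivative_transform_within_open[where S = "{0<..}"]) (use 1 in \<open>auto simp: flat_exp_def\<close>)
  next
    case 2
    have "((\<lambda>t. 0) has_real_derivative flat_exp c (flat_exp_deriv c q) t) (at t)"
      using 2 by (simp add: flat_exp_def)
    then show ?thesis
      by (rule has_field_derivative_transform_within_open[where S = "{..<0}"]) (use 2 in \<open>auto simp: flat_exp_def\<close>)
  next
    case 3
    have "((\<lambda>s. exp (- c * s) * poly (pCons 0 q) s) \<longlongrightarrow> 0) at_top"
      by (rule exp_poly_tendsto_0[OF assms])
    then have "((\<lambda>t. exp (- c * inverse t) * poly (pCons 0 q) (inverse t)) \<longlongrightarrow> 0) (at_right 0)"
      by (rule filterlim_compose[OF _ filterlim_inverse_at_top_right])
    then have "((\<lambda>t. flat_exp c q t / t) \<longlongrightarrow> 0) (at_right 0)"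
      by (rule Lim_transform_eventually)
        (auto simp: eventually_at_filter flat_exp_def divide_inverse mult_ac)
    moreover have "((\<lambda>t. flat_exp c q t / t) \<longlongrightarrow> 0) (at_left 0)"
      by (rule Lim_transform_eventually[OF tendsto_const]) (auto simp: eventually_at_filter flat_exp_def)
    ultimately have "((\<lambda>t. flat_exp c q t / t) \<longlongrightarrow> 0) (at 0)"
      by (simp add: filterlim_at_split)
    then show ?thesis using 3 by (simp add: DERIV_def flat_exp_def)
  qed
qed

text \<open>The induction is over the order of differentiability. It needs the statement for all \<open>q\<close> and with a factor
  \<open>K\<close>, because a partial derivative changes \<open>q\<close> and contributes the constant \<open>b \<bullet> v\<close>.\<close>

lemma smooth_flat_exp:
  assumes "0 < c"
  shows "smooth (\<lambda>x::'a::euclidean_space. flat_exp c q (x \<bullet> v + a))"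
proof -
  \<comment> \<open>The chain rule, in a form that exhibits each partial derivative as a member of the same family.\<close>
  have d: "((\<lambda>x. K * flat_exp c q (x \<bullet> v + a)) has_derivative
      (\<lambda>y. K * (y \<bullet> v) * flat_exp c (flat_exp_deriv c q) (x \<bullet> v + a))) (at x)"
    for K q and x :: 'a
    by (rule has_derivative_eq_rhs, rule has_derivative_mult_right,
        rule has_derivative_compose[where f = "\<lambda>x. x \<bullet> v + a", OF _
          flat_exp_has_derivative[OF assms, unfolded has_field_derivative_def]])
      (auto intro!: derivative_eq_intros)
  have "C_k k (\<lambda>x. K * flat_exp c q (x \<bullet> v + a))" for k K q
  proof (induction k arbitrary: K q)
    case 0
    have "continuous_on UNIV (\<lambda>x. K * flat_exp c q (x \<bullet> v + a))"
      using d[THEN has_derivative_continuous] continuous_at_imp_continuous_on by blast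
    then show ?case by simp
  next
    case (Suc k)
    show ?case by (rule C_k_SucI[OF d Suc.IH])
  qed
  from this[of _ 1] show ?thesis by (simp add: smooth_def)
qed

text \<open>With \<open>c = 1 / Suc n\<close> each factor tends to 1 as \<open>n\<close> grows, at every point of the open box.\<close>

definition box_bump :: "nat \<Rightarrow> 'a::euclidean_space \<Rightarrow> 'a \<Rightarrow> 'a \<Rightarrow> real" where
  "box_bump n a b x = (\<Prod>i\<in>Basis. flat_exp (1 / Suc n) 1 (x \<bullet> i + - (a \<bullet> i)) *
                                 flat_exp (1 / Suc n) 1 (x \<bullet> - i + b \<bullet> i))"

lemma box_bump_eq_0_iff: "box_bump n a b x = 0 \<longleftrightarrow> x \<notin> box a b"
  by (auto simp: box_bump_def flat_exp_def mem_box)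

lemma test_function_box_bump:
  assumes "cbox a b \<subseteq> \<Omega>"
  shows "test_function \<Omega> (box_bump n a b)"
proof -
  have "{x. box_bump n a b x \<noteq> 0} = box a b" by (auto simp: box_bump_eq_0_iff)
  moreover have "closure (box a b) \<subseteq> cbox a b" by (intro closure_minimal box_subset_cbox closed_cbox)
  moreover have "smooth (box_bump n a b)"
    unfolding box_bump_def by (intro smooth_prod smooth_mult smooth_flat_exp) auto
  moreover have "compact (closure (box a b))"
    by (simp add: compact_closure)
  ultimately show ?thesis using assms by (auto simp: test_function_def)
qed

lemma flat_exp_1_bounds: "0 \<le> c \<Longrightarrow> 0 \<le> flat_exp c 1 t \<and> flat_exp c 1 t \<le> 1"
  by (auto simp: flat_exp_def)

lemma box_bump_bounds: "0 \<le> box_bump n a b x" "box_bump n a b x \<le> 1"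
  unfolding box_bump_def
  by (intro prod_nonneg prod_le_1 ballI conjI mult_nonneg_nonneg mult_le_one; simp add: flat_exp_1_bounds)+

lemma box_bump_tendsto:
  fixes x :: "'a::euclidean_space"
  shows "(\<lambda>n. box_bump n a b x) \<longlonglongrightarrow> indicator (box a b) x"
proof (cases "x \<in> box a b")
  case True
  have "(\<lambda>n. flat_exp (1 / Suc n) 1 t) \<longlonglongrightarrow> 1" if "0 < t" for t
  proof -
    have "(\<lambda>n. exp (- ((1 / Suc n) * (1 / t)))) \<longlonglongrightarrow> exp (- (0 * (1 / t)))"
      by (intro tendsto_intros LIMSEQ_Suc[OF lim_const_over_n])
    then show ?thesis using that by (simp add: flat_exp_def)
  qed
  then have "(\<lambda>n. box_bump n a b x) \<longlonglongrightarrow> (\<Prod>i\<in>(Basis::'a set). 1 * 1)"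
    unfolding box_bump_def using True by (intro tendsto_prod tendsto_mult) (auto simp: mem_box)
  then show ?thesis using True by simp
next
  case False
  then have "box_bump n a b x = 0" for n by (simp add: box_bump_eq_0_iff)
  then show ?thesis using False by simp
qed


section \<open>Uniqueness of the weak gradient\<close>

text \<open>Boxes are closed under intersection and generate the Borel sets, so the integral vanishes over every Borel set.\<close>

lemma borel_integral_boxes_eq_0_imp_AE:
  fixes f :: "'a::euclidean_space \<Rightarrow> real"
  assumes f: "integrable lborel f"
    and boxes: "\<And>a b. (\<integral>x. indicator (box a b) x * f x \<partial>lborel) = 0"
  shows "AE x in lborel. f x = 0"
proof (rule sigma_finite_measure.density_zero[OF sigma_finite_lborel f])
  have si: "set_integrable lborel A f" if "A \<in> sets borel" for A
    using f that integrable_mult_indicator[of A lborel f] by (simp add: set_integrable_def)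
  \<comment> \<open>Complements need the integral over the whole space, an increasing limit of boxes.\<close>
  have univ: "(LINT x:UNIV|lborel. f x) = 0"
  proof -
    let ?B = "\<lambda>n::nat. box (- real n *\<^sub>R One) (real n *\<^sub>R One :: 'a)"
    have "incseq ?B"
      by (auto simp: incseq_def mem_box) (smt (verit) of_nat_mono)+
    then have "(\<lambda>n. LINT x:?B n|lborel. f x) \<longlonglongrightarrow> (LINT x:(\<Union>n. ?B n)|lborel. f x)"
      by (intro set_integral_cont_up si) auto
    then show ?thesis
      using boxes by (simp add: UN_box_eq_UNIV set_lebesgue_integral_def LIMSEQ_const_iff)
  qed
  fix A :: "'a set"
  assume "A \<in> sets lborel"
  then have A: "A \<in> sigma_sets UNIV (range (\<lambda>(a, b). box a b))"
    by (simp add: borel_eq_box)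
  have "Int_stable (range (\<lambda>(a, b). box a b :: 'a set))"
    by (auto simp: Int_stable_def box_Int_box)
  moreover have "range (\<lambda>(a, b). box a b :: 'a set) \<subseteq> Pow UNIV" by auto
  ultimately show "(LINT x:A|lborel. f x) = 0" using A
  proof (induction rule: sigma_sets_induct_disjoint)
    case (basic A)
    then show ?case using boxes by (auto simp: set_lebesgue_integral_def)
  next
    case (compl A)
    then have [measurable]: "A \<in> sets borel" by (simp add: borel_eq_box)
    have "(LINT x:A \<union> (UNIV - A)|lborel. f x) = (LINT x:A|lborel. f x) + (LINT x:UNIV - A|lborel. f x)"
      by (rule set_integral_Un) (auto intro!: si)
    then show ?case using univ compl by simp
  next
    case (union F)
    then have F: "F i \<in> sets borel" for i by (auto simp: borel_eq_box)
    have "(LINT x:(\<Union>i. F i)|lborel. f x) = (\<Sum>i. (LINT x:(F i)|lborel. f x))"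
      using union F by (intro lebesgue_integral_countable_add si) (auto simp: disjoint_family_on_def)
    then show ?case using union by simp
  qed (simp add: set_lebesgue_integral_def)
qed

lemma integral_boxes_eq_0_imp_AE:
  fixes f :: "'a::euclidean_space \<Rightarrow> real"
  assumes f: "integrable lebesgue f"
    and boxes: "\<And>a b. (\<integral>x. indicator (box a b) x * f x \<partial>lebesgue) = 0"
  shows "AE x in lebesgue. f x = 0"
proof -
  obtain g where g: "g \<in> borel_measurable lborel" "AE x in lborel. f x = g x"
    using completion_ex_borel_measurable_real[OF borel_measurable_integrable[OF f]] by blast
  have g': "g \<in> borel_measurable lebesgue"
    using g(1) by (rule measurable_completion)
  have ae: "AE x in lebesgue. f x = g x"
    using g(2) by (rule AE_completion)
  have "integrable lebesgue g"
    using f g' ae by (rule integrable_cong_AE_imp)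
  then have ig: "integrable lborel g"
    using g(1) by (simp add: integrable_completion)
  have "(\<integral>x. indicator (box a b) x * g x \<partial>lborel) = 0" for a b
  proof -
    have "(\<integral>x. indicator (box a b) x * g x \<partial>lborel) = (\<integral>x. indicator (box a b) x * g x \<partial>lebesgue)"
      using g(1) by (intro integral_completion[symmetric]) auto
    also have "\<dots> = (\<integral>x. indicator (box a b) x * f x \<partial>lebesgue)"
      using g' ae borel_measurable_integrable[OF f]
      by (intro integral_cong_AE borel_measurable_times borel_measurable_indicator) auto
    finally show ?thesis using boxes by simp
  qed
  from AE_completion[OF borel_integral_boxes_eq_0_imp_AE[OF ig this]] ae
  show ?thesis by eventually_elim simp
qed

text \<open>By dominated convergence along \<open>box_bump\<close>, the integral of \<open>u\<close> vanishes over every box whose closure lies in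
  \<open>\<Omega>\<close>. Inside one such box the intersection with any other box is of the same kind, so \<open>u\<close> vanishes there almost
  everywhere, and countably many closed boxes cover \<open>\<Omega>\<close>.\<close>

lemma fundamental_lemma_variations:
  fixes u :: "'a::euclidean_space \<Rightarrow> real"
  assumes \<Omega>: "open \<Omega>" and u: "integrable (lebesgue_on \<Omega>) u"
    and test: "\<And>\<phi>. test_function \<Omega> \<phi> \<Longrightarrow> (\<integral>x. u x * \<phi> x \<partial>lebesgue_on \<Omega>) = 0"
  shows "AE x in lebesgue_on \<Omega>. u x = 0"
proof -
  have S: "\<Omega> \<inter> space lebesgue \<in> sets lebesgue" using \<Omega> by auto
  have uL: "integrable lebesgue (\<lambda>x. indicator \<Omega> x * u x)"
    using u integrable_restrict_space[OF S, of u] by simp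
  have box: "(\<integral>x. indicator (box a b) x * u x \<partial>lebesgue) = 0"
    and boxi: "integrable lebesgue (\<lambda>x. indicator (box a b) x * u x)" if ab: "cbox a b \<subseteq> \<Omega>" for a b
  proof -
    have eq: "indicator (box a b) x * u x = indicator (box a b) x * (indicator \<Omega> x * u x)" for x
      using ab box_subset_cbox[of a b] by (auto simp: indicator_def)
    show "integrable lebesgue (\<lambda>x. indicator (box a b) x * u x)"
      unfolding eq using integrable_mult_indicator[OF _ uL, of "box a b"] by simp
    have smooth_meas: "box_bump n a b \<in> borel_measurable (lebesgue_on \<Omega>)" for n
    proof -
      have "C_k 0 (box_bump n a b)"
        using test_function_box_bump[OF ab] by (simp add: test_function_def smooth_def del: C_k.simps)
      then have "box_bump n a b \<in> borel_measurable borel"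
        by (simp add: borel_measurable_continuous_onI)
      then show ?thesis by (intro measurable_restrict_space1 measurable_completion) simp
    qed
    have "(\<lambda>n. \<integral>x. u x * box_bump n a b x \<partial>lebesgue_on \<Omega>) \<longlonglongrightarrow> (\<integral>x. u x * indicator (box a b) x \<partial>lebesgue_on \<Omega>)"
    proof (rule integral_dominated_convergence[where w = "\<lambda>x. norm (u x)"])
      show "(\<lambda>x. u x * indicator (box a b) x) \<in> borel_measurable (lebesgue_on \<Omega>)"
      proof (rule borel_measurable_times[OF borel_measurable_integrable[OF u]])
        show "indicator (box a b) \<in> borel_measurable (lebesgue_on \<Omega>)"
          by (rule measurable_restrict_space1) (auto intro: borel_measurable_indicator)
      qed
      show "(\<lambda>x. u x * box_bump n a b x) \<in> borel_measurable (lebesgue_on \<Omega>)" for n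
        using borel_measurable_integrable[OF u] smooth_meas by (intro borel_measurable_times)
      show "integrable (lebesgue_on \<Omega>) (\<lambda>x. norm (u x))" using u by (rule integrable_norm)
      show "AE x in lebesgue_on \<Omega>. (\<lambda>n. u x * box_bump n a b x) \<longlonglongrightarrow> u x * indicator (box a b) x"
        by (intro AE_I2 tendsto_intros box_bump_tendsto)
      show "AE x in lebesgue_on \<Omega>. norm (u x * box_bump n a b x) \<le> norm (u x)" for n
        using box_bump_bounds[of n a b] by (intro AE_I2) (auto simp: abs_mult intro!: mult_left_le)
    qed
    then have "(\<integral>x. u x * indicator (box a b) x \<partial>lebesgue_on \<Omega>) = 0"
      using test[OF test_function_box_bump[OF ab]] by (simp add: LIMSEQ_const_iff)
    then show "(\<integral>x. indicator (box a b) x * u x \<partial>lebesgue) = 0"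
      unfolding eq using integral_restrict_space[OF S, of "\<lambda>x. u x * indicator (box a b) x"]
      by (simp add: mult_ac)
  qed
  have cboxAE: "AE x in lebesgue. x \<in> cbox a b \<longrightarrow> u x = 0" if ab: "cbox a b \<subseteq> \<Omega>" for a b
  proof -
    have "AE x in lebesgue. indicator (box a b) x * u x = 0"
    proof (rule integral_boxes_eq_0_imp_AE[OF boxi[OF ab]])
      fix c d :: 'a
      obtain c' d' where cd: "box a b \<inter> box c d = box c' d'"
        using box_Int_box by blast
      have eq: "indicator (box c d) x * (indicator (box a b) x * u x) = indicator (box c' d') x * u x" for x
        unfolding cd[symmetric] by (auto simp: indicator_def)
      show "(\<integral>x. indicator (box c d) x * (indicator (box a b) x * u x) \<partial>lebesgue) = 0"
      proof (cases "box c' d' = {}")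
        case False
        \<comment> \<open>The intersection is nonempty, so its closed box is its closure and stays inside \<open>cbox a b\<close>.\<close>
        have "cbox c' d' = closure (box c' d')" using False by (rule closure_box[symmetric])
        also have "\<dots> \<subseteq> cbox a b"
          unfolding cd[symmetric] using box_subset_cbox[of a b] by (intro closure_minimal closed_cbox) auto
        finally show ?thesis unfolding eq using ab by (intro box) auto
      qed (simp add: eq)
    qed
    moreover have "AE x in lebesgue. x \<notin> cbox a b - box a b"
      by (rule AE_not_in) (use negligible_frontier_interval in \<open>auto simp: negligible_iff_null_sets\<close>)
    ultimately show ?thesis by eventually_elim auto
  qed
  obtain \<D> where D: "countable \<D>" "\<D> \<subseteq> Pow \<Omega>" "\<And>X. X \<in> \<D> \<Longrightarrow> \<exists>a b. X = cbox a b" "\<Union>\<D> = \<Omega>"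
    using open_countable_Union_open_cbox[OF \<Omega>] by metis
  have "AE x in lebesgue. \<forall>X\<in>\<D>. x \<in> X \<longrightarrow> u x = 0"
  proof (rule AE_ball_countable'[OF _ D(1)])
    fix X assume "X \<in> \<D>"
    then obtain a b where "X = cbox a b" "cbox a b \<subseteq> \<Omega>" using D(2,3) by blast
    then show "AE x in lebesgue. x \<in> X \<longrightarrow> u x = 0" using cboxAE by simp
  qed
  then have "AE x in lebesgue. x \<in> \<Omega> \<longrightarrow> u x = 0"
    by eventually_elim (use D(4) in auto)
  then show ?thesis using AE_restrict_space_iff[OF S] by simp
qed

lemma weak_gradient_unique:
  fixes \<Omega> :: "'a::euclidean_space set"
  assumes \<Omega>: "open \<Omega>" "\<Omega> \<subseteq> cbox p q"
    and v: "v \<in> L2 (lebesgue_on \<Omega>)" "has_weak_gradient \<Omega> w v"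
    and v': "v' \<in> L2 (lebesgue_on \<Omega>)" "has_weak_gradient \<Omega> w v'"
  shows "AE x in lebesgue_on \<Omega>. v x = v' x"
proof -
  have S: "\<Omega> \<in> sets borel" using \<Omega> by auto
  have "AE x in lebesgue_on \<Omega>. (v x - v' x) \<bullet> b = 0" if b: "b \<in> Basis" for b
  proof (rule fundamental_lemma_variations[OF \<Omega>(1)])
    have i: "integrable (lebesgue_on \<Omega>) (\<lambda>x. z x \<bullet> b)" if "z \<in> L2 (lebesgue_on \<Omega>)" for z
      by (rule integrable_inner_L2[OF that continuous_L2[OF _ \<Omega>(2) S]]) simp
    show "integrable (lebesgue_on \<Omega>) (\<lambda>x. (v x - v' x) \<bullet> b)"
      using i[OF v(1)] i[OF v'(1)] by (simp add: inner_diff_left)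
    fix \<phi> assume \<phi>: "test_function \<Omega> \<phi>"
    then have "C_k 0 \<phi>" by (simp add: test_function_def smooth_def del: C_k.simps)
    then have "(\<lambda>x. \<phi> x *\<^sub>R b) \<in> L2 (lebesgue_on \<Omega>)"
      by (intro continuous_L2[OF _ \<Omega>(2) S] continuous_intros) simp
    from integrable_inner_L2[OF v(1) this] integrable_inner_L2[OF v'(1) this]
    have "integrable (lebesgue_on \<Omega>) (\<lambda>x. (v x \<bullet> b) * \<phi> x)" "integrable (lebesgue_on \<Omega>) (\<lambda>x. (v' x \<bullet> b) * \<phi> x)"
      by (simp_all add: mult.commute)
    moreover have "(\<integral>x. (v x \<bullet> b) * \<phi> x \<partial>lebesgue_on \<Omega>) = (\<integral>x. (v' x \<bullet> b) * \<phi> x \<partial>lebesgue_on \<Omega>)"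
      using v(2) v'(2) \<phi> b by (force simp: has_weak_gradient_def)
    ultimately show "(\<integral>x. (v x - v' x) \<bullet> b * \<phi> x \<partial>lebesgue_on \<Omega>) = 0"
      by (simp add: inner_diff_left left_diff_distrib)
  qed
  then have "AE x in lebesgue_on \<Omega>. \<forall>b\<in>Basis. (v x - v' x) \<bullet> b = 0"
    by (intro AE_ball_countable') (auto simp: countable_finite)
  then show ?thesis by eventually_elim (auto intro: euclidean_eqI simp: inner_diff_left)
qed


section \<open>Integration over the triangle by rows and columns\<close>

lemma mem_right_triangle:
  "(x, y) \<in> right_triangle h \<longleftrightarrow> \<bar>y\<bar> < x \<and> x < h"
  by (auto simp: right_triangle_def)

lemma open_right_triangle: "open (right_triangle h)"
proof -
  have "right_triangle h = {p. \<bar>snd p\<bar> < fst p} \<inter> {p. fst p < h}"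
    by (auto simp: right_triangle_def)
  then show ?thesis by (auto intro!: open_Int open_Collect_less continuous_intros)
qed

lemma right_triangle_subset_cbox: "right_triangle h \<subseteq> cbox (0, -h) (h, h)"
  by (auto simp: right_triangle_def cbox_Pair_eq)

lemma sets_right_triangle: "right_triangle h \<in> sets borel" "right_triangle h \<in> sets lebesgue"
  using open_right_triangle by (auto intro: borel_open)

lemma integrable_triangle:
  "continuous_on UNIV P \<Longrightarrow> integrable (lebesgue_on (right_triangle h)) (P :: _ \<Rightarrow> real)"
  by (rule integrable_continuous_bounded[OF _ right_triangle_subset_cbox sets_right_triangle(1)])

lemma L2_triangle:
  "continuous_on UNIV F \<Longrightarrow> F \<in> L2 (lebesgue_on (right_triangle h))"
  by (rule continuous_L2[OF _ right_triangle_subset_cbox sets_right_triangle(1)])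

lemma integral_lebesgue_on_borel:
  fixes P :: "'a::euclidean_space \<Rightarrow> real"
  assumes "P \<in> borel_measurable borel" "S \<in> sets borel"
  shows "(\<integral>z. P z \<partial>lebesgue_on S) = (\<integral>z. indicator S z * P z \<partial>lborel)"
proof -
  have "(\<integral>z. P z \<partial>lebesgue_on S) = (\<integral>z. indicator S z * P z \<partial>lebesgue)"
    using assms(2) by (subst integral_restrict_space) auto
  also have "\<dots> = (\<integral>z. indicator S z * P z \<partial>lborel)"
    using assms by (intro integral_completion) auto
  finally show ?thesis .
qed

lemma lborel_integral_interval:
  fixes g :: "real \<Rightarrow> real"
  assumes "integrable lborel (\<lambda>x. indicator {a<..<b} x * g x)"
  shows "(g has_integral (\<integral>x. indicator {a<..<b} x * g x \<partial>lborel)) {a..b}"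
proof -
  have s: "set_integrable lborel {a<..<b} g" using assms by (simp add: set_integrable_def)
  have "g integrable_on {a<..<b}" "(\<integral>x. indicator {a<..<b} x * g x \<partial>lborel) = integral {a<..<b} g"
    using set_borel_integral_eq_integral[OF s] by (auto simp: set_lebesgue_integral_def)
  then show ?thesis
    by (simp add: has_integral_integral[symmetric] integrable_on_open_interval_real
        integral_open_interval_real has_integral_iff)
qed

lemma has_integral_symmetrize:
  fixes f :: "real \<Rightarrow> real"
  assumes "0 \<le> c" "(f has_integral I) {-c..c}"
  shows "((\<lambda>t. f t + f (-t)) has_integral I) {0..c}"
proof -
  have i: "f integrable_on {-c..0}" "f integrable_on {0..c}"
    using assms by (auto intro: integrable_subinterval_real has_integral_integrable)
  have "integral {-c..0} f + integral {0..c} f = I"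
    using assms by (metis Henstock_Kurzweil_Integration.integral_combine has_integral_integrable integral_unique neg_le_0_iff_le)
  moreover have "((\<lambda>t. f (-t)) has_integral integral {-c..0} f) {0..c}"
    using has_integral_reflect_real[where f = f and a = "-c" and b = 0] i(1) by (simp add: has_integral_integral)
  ultimately show ?thesis
    using has_integral_add[of "f" "integral {0..c} f" "{0..c}" "\<lambda>t. f (-t)" "integral {-c..0} f"] i
    by (simp add: has_integral_integral add.commute)
qed

lemma integral_symmetrize:
  fixes f :: "real \<Rightarrow> real"
  assumes "0 \<le> c" "continuous_on UNIV f"
  shows "integral {-c..c} f = integral {0..c} (\<lambda>t. f t + f (-t))"
  using assms has_integral_symmetrize[of c f "integral {-c..c} f"]
  by (metis continuous_on_subset has_integral_integral integrable_continuous_real integral_unique subset_UNIV)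

lemma continuous_on_row: "continuous_on UNIV P \<Longrightarrow> continuous_on S (\<lambda>x::real. P (x, c::real))"
  by (rule continuous_on_compose2[of UNIV P]) (auto intro!: continuous_intros)

lemma continuous_on_column: "continuous_on UNIV P \<Longrightarrow> continuous_on S (\<lambda>y::real. P (c::real, y))"
  by (rule continuous_on_compose2[of UNIV P]) (auto intro!: continuous_intros)

text \<open>Fubini's theorem, with the points above and below the axis paired. The pairing makes rows and columns
  integrals over the same interval \<open>{0..h}\<close>, so that they can be added pointwise.\<close>

lemma triangle_rows:
  fixes P :: "real \<times> real \<Rightarrow> real"
  assumes "0 < h" "continuous_on UNIV P"
  shows "((\<lambda>t. integral {t..h} (\<lambda>x. P (x, t) + P (x, -t))) has_integral
     (\<integral>z. P z \<partial>lebesgue_on (right_triangle h))) {0..h}"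
proof -
  let ?K = "\<lambda>z. indicator (right_triangle h) z * P z"
  have K: "integrable (lborel \<Otimes>\<^sub>M lborel) ?K"
    unfolding lborel_prod
    by (intro integrable_lborel_indicator_continuous[OF assms(2) right_triangle_subset_cbox] sets_right_triangle)
  have c: "continuous_on S (\<lambda>x. P (x, y))" for S y
    by (rule continuous_on_compose2[OF assms(2)]) (auto intro!: continuous_intros)
  have io: "(\<lambda>x. P (x, y)) integrable_on {a..b}" for a b y
    by (intro integrable_continuous_real c)
  have Keq: "?K (x, y) = indicator {-h<..<h} y * (indicator {\<bar>y\<bar><..<h} x * P (x, y))" for x y
    by (auto simp: indicator_def mem_right_triangle)
  have row: "(\<integral>x. ?K (x, y) \<partial>lborel) = indicator {-h<..<h} y * integral {\<bar>y\<bar>..h} (\<lambda>x. P (x, y))" for y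
  proof -
    have "integrable lborel (\<lambda>x. indicator {\<bar>y\<bar><..<h} x * P (x, y))"
      by (intro integrable_lborel_indicator_continuous[OF c, of _ "\<bar>y\<bar>" h]) auto
    from integral_unique[OF lborel_integral_interval[OF this]] show ?thesis
      unfolding Keq by simp
  qed
  have 1: "integrable lborel (\<lambda>y. \<integral>x. ?K (x, y) \<partial>lborel)"
    using lborel_pair.integrable_snd[of "\<lambda>x y. ?K (x, y)"] K by (simp add: case_prod_unfold)
  have 2: "(\<integral>y. (\<integral>x. ?K (x, y) \<partial>lborel) \<partial>lborel) = (\<integral>z. ?K z \<partial>lborel)"
    using lborel_pair.integral_snd[of "\<lambda>x y. ?K (x, y)"] K by (simp add: case_prod_unfold lborel_prod)
  have "((\<lambda>y. integral {\<bar>y\<bar>..h} (\<lambda>x. P (x, y))) has_integral (\<integral>z. ?K z \<partial>lborel)) {-h..h}"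
    using lborel_integral_interval[OF 1[unfolded row]] unfolding 2[symmetric] row .
  then have "((\<lambda>y. integral {\<bar>y\<bar>..h} (\<lambda>x. P (x, y)) + integral {\<bar>-y\<bar>..h} (\<lambda>x. P (x, -y)))
     has_integral (\<integral>z. ?K z \<partial>lborel)) {0..h}"
    by (intro has_integral_symmetrize[of h]) (use assms in auto)
  also have "(\<integral>z. ?K z \<partial>lborel) = (\<integral>z. P z \<partial>lebesgue_on (right_triangle h))"
    using assms by (intro integral_lebesgue_on_borel[symmetric] borel_measurable_continuous_onI sets_right_triangle)
  finally show ?thesis
    by (rule has_integral_eq[rotated]) (auto simp: integral_add[OF io io])
qed

lemma triangle_columns:
  fixes P :: "real \<times> real \<Rightarrow> real"
  assumes "0 < h" "continuous_on UNIV P"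
  shows "((\<lambda>t. integral {0..t} (\<lambda>y. P (t, y) + P (t, -y))) has_integral
     (\<integral>z. P z \<partial>lebesgue_on (right_triangle h))) {0..h}"
proof -
  let ?K = "\<lambda>z. indicator (right_triangle h) z * P z"
  have K: "integrable (lborel \<Otimes>\<^sub>M lborel) ?K"
    unfolding lborel_prod
    by (intro integrable_lborel_indicator_continuous[OF assms(2) right_triangle_subset_cbox] sets_right_triangle)
  have c: "continuous_on S (\<lambda>y. P (x, y))" for S x
    by (rule continuous_on_compose2[OF assms(2)]) (auto intro!: continuous_intros)
  have Keq: "?K (x, y) = indicator {0<..<h} x * (indicator {-x<..<x} y * P (x, y))" for x y
    by (auto simp: indicator_def mem_right_triangle)
  have column: "(\<integral>y. ?K (x, y) \<partial>lborel) =
      indicator {0<..<h} x * integral {0..x} (\<lambda>y. P (x, y) + P (x, -y))" for x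
  proof (cases "0 < x")
    case True
    have "integrable lborel (\<lambda>y. indicator {-x<..<x} y * P (x, y))"
      by (intro integrable_lborel_indicator_continuous[OF c, of _ "-x" x]) auto
    from integral_unique[OF has_integral_symmetrize[OF _ lborel_integral_interval[OF this]]] True
    show ?thesis unfolding Keq by simp
  qed (simp add: Keq)
  have 1: "integrable lborel (\<lambda>x. \<integral>y. ?K (x, y) \<partial>lborel)"
    using lborel_pair.integrable_fst[of "\<lambda>x y. ?K (x, y)"] K by (simp add: case_prod_unfold)
  have 2: "(\<integral>x. (\<integral>y. ?K (x, y) \<partial>lborel) \<partial>lborel) = (\<integral>z. ?K z \<partial>lborel)"
    using lborel_pair.integral_fst[of "\<lambda>x y. ?K (x, y)"] K by (simp add: case_prod_unfold lborel_prod)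
  have "((\<lambda>x. integral {0..x} (\<lambda>y. P (x, y) + P (x, -y))) has_integral (\<integral>z. ?K z \<partial>lborel)) {0..h}"
    using lborel_integral_interval[OF 1[unfolded column]] unfolding 2[symmetric] column .
  also have "(\<integral>z. ?K z \<partial>lborel) = (\<integral>z. P z \<partial>lebesgue_on (right_triangle h))"
    using assms by (intro integral_lebesgue_on_borel[symmetric] borel_measurable_continuous_onI sets_right_triangle)
  finally show ?thesis .
qed

text \<open>Continuous partial derivatives as data, so that even and odd parts can be treated by giving their partial
  derivatives explicitly.\<close>

definition C1_partials :: "(real \<times> real \<Rightarrow> real) \<Rightarrow> (real \<times> real \<Rightarrow> real) \<Rightarrow> (real \<times> real \<Rightarrow> real) \<Rightarrow> bool" where
  "C1_partials w w1 w2 \<longleftrightarrow>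
     continuous_on UNIV w \<and> continuous_on UNIV w1 \<and> continuous_on UNIV w2 \<and>
     (\<forall>x y. ((\<lambda>x. w (x, y)) has_real_derivative w1 (x, y)) (at x) \<and>
            ((\<lambda>y. w (x, y)) has_real_derivative w2 (x, y)) (at y))"

lemma C1_partials_continuous:
  assumes "C1_partials w w1 w2"
  shows "continuous_on UNIV w" "continuous_on UNIV w1" "continuous_on UNIV w2"
  using assms by (auto simp: C1_partials_def)

lemma C1_partials_reflect:
  assumes "C1_partials w w1 w2"
  shows "C1_partials (\<lambda>p. w (fst p, - snd p)) (\<lambda>p. w1 (fst p, - snd p)) (\<lambda>p. - w2 (fst p, - snd p))"
proof -
  have c: "continuous_on UNIV (\<lambda>p::real \<times> real. u (fst p, - snd p))"
    if "continuous_on UNIV u" for u :: "real \<times> real \<Rightarrow> real"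
    by (rule continuous_on_compose2[OF that]) (auto intro!: continuous_intros)
  have "((\<lambda>y. w (x, - y)) has_real_derivative - w2 (x, - y)) (at y)" for x y
  proof -
    have "((\<lambda>y. w (x, y)) has_real_derivative w2 (x, - y)) (at (- y))"
      using assms by (simp add: C1_partials_def)
    then show ?thesis
      using DERIV_chain2[of "\<lambda>y. w (x, y)" "w2 (x, - y)" uminus y "-1" UNIV]
      by (simp add: DERIV_minus[OF DERIV_ident, of y])
  qed
  then show ?thesis
    using assms unfolding C1_partials_def by (auto intro!: c continuous_intros)
qed

lemma C1_partials_linear:
  assumes "C1_partials u u1 u2" "C1_partials v v1 v2"
  shows "C1_partials (\<lambda>p. a * u p + b * v p) (\<lambda>p. a * u1 p + b * v1 p) (\<lambda>p. a * u2 p + b * v2 p)"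
  using assms unfolding C1_partials_def
  by (auto intro!: continuous_intros derivative_eq_intros)

lemma gradient_real_prod:
  fixes \<phi> :: "real \<times> real \<Rightarrow> real"
  shows "gradient \<phi> z = (frechet_derivative \<phi> (at z) (1, 0), frechet_derivative \<phi> (at z) (0, 1))"
  by (simp add: gradient_def Basis_prod_def)

lemma smooth_C1_partials:
  fixes \<phi> :: "real \<times> real \<Rightarrow> real"
  assumes "smooth \<phi>"
  shows "C1_partials \<phi> (\<lambda>z. fst (gradient \<phi> z)) (\<lambda>z. snd (gradient \<phi> z))"
proof -
  have "continuous_on UNIV (\<lambda>z. fst (gradient \<phi> z))" "continuous_on UNIV (\<lambda>z. snd (gradient \<phi> z))"
    by (intro continuous_intros continuous_gradient assms)+
  moreover have "((\<lambda>x. \<phi> (x, y)) has_real_derivative fst (gradient \<phi> (x, y))) (at x)" for x y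
  proof -
    have "((\<lambda>x. \<phi> (x, y)) has_derivative (\<lambda>t. frechet_derivative \<phi> (at (x, y)) (t, 0))) (at x)"
      by (rule has_derivative_compose[OF _ smooth_has_derivative[OF assms], of "\<lambda>x. (x, y)"])
        (auto intro!: derivative_eq_intros)
    moreover have "frechet_derivative \<phi> (at (x, y)) (t, 0) = t * fst (gradient \<phi> (x, y))" for t
      using linear_scale[OF has_derivative_linear[OF smooth_has_derivative[OF assms]], of "(x, y)" t "(1, 0)"]
      by (simp add: gradient_real_prod)
    ultimately show ?thesis by (simp add: has_field_derivative_def mult.commute[of "fst _"] mult_commute_abs)
  qed
  moreover have "((\<lambda>y. \<phi> (x, y)) has_real_derivative snd (gradient \<phi> (x, y))) (at y)" for x y
  proof -
    have "((\<lambda>y. \<phi> (x, y)) has_derivative (\<lambda>t. frechet_derivative \<phi> (at (x, y)) (0, t))) (at y)"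
      by (rule has_derivative_compose[OF _ smooth_has_derivative[OF assms], of "\<lambda>y. (x, y)"])
        (auto intro!: derivative_eq_intros)
    moreover have "frechet_derivative \<phi> (at (x, y)) (0, t) = t * snd (gradient \<phi> (x, y))" for t
      using linear_scale[OF has_derivative_linear[OF smooth_has_derivative[OF assms]], of "(x, y)" t "(0, 1)"]
      by (simp add: gradient_real_prod)
    ultimately show ?thesis by (simp add: has_field_derivative_def mult_commute_abs)
  qed
  ultimately show ?thesis using smooth_continuous[OF assms] by (simp add: C1_partials_def)
qed

text \<open>The divergence theorem for the field \<open>w (x, y) * (x, y)\<close>. Integrating \<open>d/dx (x * w)\<close> over rows and
  \<open>d/dy (y * w)\<close> over columns, the contributions of the legs at \<open>(t, t)\<close> and \<open>(t, - t)\<close> cancel.\<close>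

lemma C1_trace_mean:
  assumes h: "0 < h" and w: "C1_partials w w1 w2"
  shows "h * integral {-h..h} (\<lambda>t. w (h, t)) =
     (\<integral>z. 2 * w z + (fst z * w1 z + snd z * w2 z) \<partial>lebesgue_on (right_triangle h))"
proof -
  let ?P = "\<lambda>z. w z + fst z * w1 z" and ?Q = "\<lambda>z. w z + snd z * w2 z"
  have c: "continuous_on UNIV w" "continuous_on UNIV w1" "continuous_on UNIV w2"
    using C1_partials_continuous[OF w] .
  have cP: "continuous_on UNIV ?P" and cQ: "continuous_on UNIV ?Q"
    by (auto intro!: continuous_intros c)
  have d1: "((\<lambda>x. w (x, y)) has_real_derivative w1 (x, y)) (at x within S)"
    and d2: "((\<lambda>y. w (x, y)) has_real_derivative w2 (x, y)) (at y within S)" for x y S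
    using w by (auto simp: C1_partials_def intro: has_field_derivative_at_within)
  have d2': "((\<lambda>y. w (x, - y)) has_real_derivative - w2 (x, - y)) (at y within S)" for x y S
    using C1_partials_reflect[OF w] by (auto simp: C1_partials_def intro: has_field_derivative_at_within)
  have rows: "integral {t..h} (\<lambda>x. ?P (x, t) + ?P (x, -t)) =
      (h * w (h, t) + h * w (h, -t)) - (t * w (t, t) + t * w (t, -t))" if "t \<in> {0..h}" for t
    using that by (intro integral_unique fundamental_theorem_of_calculus)
      (auto intro!: derivative_eq_intros d1 simp: has_real_derivative_iff_has_vector_derivative[symmetric])
  have columns: "integral {0..t} (\<lambda>y. ?Q (t, y) + ?Q (t, -y)) =
      (t * w (t, t) + t * w (t, -t)) - (0 * w (t, 0) + 0 * w (t, - 0))" if "t \<in> {0..h}" for t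
    using that by (intro integral_unique fundamental_theorem_of_calculus)
      (auto intro!: derivative_eq_intros d2 d2' simp: has_real_derivative_iff_has_vector_derivative[symmetric])
  have "((\<lambda>t. h * (w (h, t) + w (h, -t))) has_integral
      (\<integral>z. ?P z \<partial>lebesgue_on (right_triangle h)) + (\<integral>z. ?Q z \<partial>lebesgue_on (right_triangle h))) {0..h}"
    by (rule has_integral_eq[OF _ has_integral_add[OF triangle_rows[OF h cP] triangle_columns[OF h cQ]]])
      (simp only: rows columns, simp add: algebra_simps)
  then have "h * integral {0..h} (\<lambda>t. w (h, t) + w (h, -t)) =
      (\<integral>z. ?P z \<partial>lebesgue_on (right_triangle h)) + (\<integral>z. ?Q z \<partial>lebesgue_on (right_triangle h))"
    by (simp add: integral_unique flip: integral_mult_right)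
  also have "\<dots> = (\<integral>z. ?P z + ?Q z \<partial>lebesgue_on (right_triangle h))"
    by (intro Bochner_Integration.integral_add[symmetric] cP cQ
        integrable_continuous_bounded[OF _ right_triangle_subset_cbox sets_right_triangle(1)])
  also have "\<dots> = (\<integral>z. 2 * w z + (fst z * w1 z + snd z * w2 z) \<partial>lebesgue_on (right_triangle h))"
    by (intro Bochner_Integration.integral_cong) auto
  finally show ?thesis
    using h integral_symmetrize[OF _ continuous_on_column[OF c(1), of UNIV h], of h] by simp
qed

text \<open>Each row and each column ends on the boundary, or on the axis where the contributions of its two halves
  cancel.\<close>

lemma integral_partials_eq_0:
  assumes h: "0 < h" and w: "C1_partials w w1 w2" and z: "\<And>z. z \<notin> right_triangle h \<Longrightarrow> w z = 0"
  shows "(\<integral>z. w1 z \<partial>lebesgue_on (right_triangle h)) = 0"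
    and "(\<integral>z. w2 z \<partial>lebesgue_on (right_triangle h)) = 0"
proof -
  have d1: "((\<lambda>x. w (x, y)) has_real_derivative w1 (x, y)) (at x within S)"
    and d2: "((\<lambda>y. w (x, y)) has_real_derivative w2 (x, y)) (at y within S)" for x y S
    using w by (auto simp: C1_partials_def intro: has_field_derivative_at_within)
  have d2': "((\<lambda>y. w (x, - y)) has_real_derivative - w2 (x, - y)) (at y within S)" for x y S
    using C1_partials_reflect[OF w] by (auto simp: C1_partials_def intro: has_field_derivative_at_within)
  have rows: "integral {t..h} (\<lambda>x. w1 (x, t) + w1 (x, -t)) =
      (w (h, t) + w (h, -t)) - (w (t, t) + w (t, -t))" if "t \<in> {0..h}" for t
    using that by (intro integral_unique fundamental_theorem_of_calculus)
      (auto intro!: derivative_eq_intros d1 simp: has_real_derivative_iff_has_vector_derivative[symmetric])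
  have columns: "integral {0..t} (\<lambda>y. w2 (t, y) + w2 (t, -y)) =
      (w (t, t) - w (t, -t)) - (w (t, 0) - w (t, - 0))" if "t \<in> {0..h}" for t
    using that by (intro integral_unique fundamental_theorem_of_calculus)
      (auto intro!: derivative_eq_intros d2 d2' simp: has_real_derivative_iff_has_vector_derivative[symmetric])
  have b: "w (h, t) = 0" "w (t, t) = 0" "w (t, -t) = 0" for t
    by (auto intro!: z simp: right_triangle_def)
  have "((\<lambda>t. 0) has_integral (\<integral>z. w1 z \<partial>lebesgue_on (right_triangle h))) {0..h}"
    by (rule has_integral_eq[OF _ triangle_rows[OF h C1_partials_continuous(2)[OF w]]]) (simp add: rows b)
  then show "(\<integral>z. w1 z \<partial>lebesgue_on (right_triangle h)) = 0"
    using has_integral_0 has_integral_unique by blast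
  have "((\<lambda>t. 0) has_integral (\<integral>z. w2 z \<partial>lebesgue_on (right_triangle h))) {0..h}"
    by (rule has_integral_eq[OF _ triangle_columns[OF h C1_partials_continuous(3)[OF w]]]) (simp add: columns b)
  then show "(\<integral>z. w2 z \<partial>lebesgue_on (right_triangle h)) = 0"
    using has_integral_0 has_integral_unique by blast
qed


section \<open>The trace inequality for continuously differentiable functions\<close>

text \<open>With \<open>m\<close> the mean slope, this is the integral of \<open>(g' x - m)\<^sup>2 \<ge> 0\<close>.\<close>

lemma square_increment_le_energy:
  fixes g g' :: "real \<Rightarrow> real"
  assumes "a \<le> b" "\<And>x. (g has_real_derivative g' x) (at x)" "continuous_on UNIV g'"
  shows "(g b - g a)\<^sup>2 \<le> (b - a) * integral {a..b} (\<lambda>x. (g' x)\<^sup>2)"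
proof (cases "a = b")
  case False
  with assms have ab: "a < b" by simp
  define m where "m = (g b - g a) / (b - a)"
  have c: "continuous_on {a..b} g'" using assms(3) continuous_on_subset by blast
  have d: "(g' has_integral (g b - g a)) {a..b}"
    using assms by (intro fundamental_theorem_of_calculus)
      (auto simp: has_real_derivative_iff_has_vector_derivative[symmetric] intro: has_field_derivative_at_within)
  have i: "((\<lambda>x. (g' x)\<^sup>2) has_integral integral {a..b} (\<lambda>x. (g' x)\<^sup>2)) {a..b}"
    by (intro integrable_integral integrable_continuous_real continuous_intros c)
  have mm: "((\<lambda>x. m\<^sup>2) has_integral ((b - a) * m\<^sup>2)) {a..b}"
    using has_integral_const_real[of "m\<^sup>2" a b] ab by simp
  have "((\<lambda>x. (g' x)\<^sup>2 - (2 * m) * g' x + m\<^sup>2) has_integral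
      (integral {a..b} (\<lambda>x. (g' x)\<^sup>2) - (2 * m) * (g b - g a) + (b - a) * m\<^sup>2)) {a..b}"
    by (intro has_integral_add has_integral_diff has_integral_mult_right i d mm)
  moreover have "(g' x)\<^sup>2 - (2 * m) * g' x + m\<^sup>2 \<ge> 0" for x
    using zero_le_power2[of "g' x - m"] by (simp add: power2_diff algebra_simps)
  ultimately have "integral {a..b} (\<lambda>x. (g' x)\<^sup>2) - (2 * m) * (g b - g a) + (b - a) * m\<^sup>2 \<ge> 0"
    using has_integral_nonneg by blast
  moreover have "g b - g a = m * (b - a)" using ab by (simp add: m_def)
  ultimately have "m\<^sup>2 * (b - a) \<le> integral {a..b} (\<lambda>x. (g' x)\<^sup>2)"
    by (simp add: power2_eq_square algebra_simps)
  then have "(b - a) * (m\<^sup>2 * (b - a)) \<le> (b - a) * integral {a..b} (\<lambda>x. (g' x)\<^sup>2)"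
    using ab by (intro mult_left_mono) auto
  moreover have "(g b - g a)\<^sup>2 = (b - a) * (m\<^sup>2 * (b - a))"
    by (simp add: \<open>g b - g a = m * (b - a)\<close> power2_eq_square)
  ultimately show ?thesis by simp
qed simp

lemma horizontal_increment:
  assumes "C1_partials w w1 w2" "a \<le> b"
  shows "(w (b, y) - w (a, y))\<^sup>2 \<le> (b - a) * integral {a..b} (\<lambda>x. (w1 (x, y))\<^sup>2)"
  using assms by (intro square_increment_le_energy) (auto simp: C1_partials_def intro: continuous_on_row)

lemma vertical_increment:
  assumes "C1_partials w w1 w2" "a \<le> b"
  shows "(w (x, b) - w (x, a))\<^sup>2 \<le> (b - a) * integral {a..b} (\<lambda>y. (w2 (x, y))\<^sup>2)"
  using assms by (intro square_increment_le_energy[where g = "\<lambda>y. w (x, y)"])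
    (auto simp: C1_partials_def intro: continuous_on_column)

text \<open>Joins the estimates for two pieces of a path: lengths \<open>a\<close>, \<open>b\<close> and energies \<open>P\<close>, \<open>Q\<close> add up. It is the
  Cauchy-Schwarz inequality for the vectors \<open>(sqrt a, sqrt b)\<close> and \<open>(sqrt P, sqrt Q)\<close>.\<close>

lemma power2_sum_le:
  fixes p q :: real
  assumes "p\<^sup>2 \<le> a * P" "q\<^sup>2 \<le> b * Q" "0 \<le> a" "0 \<le> b" "0 \<le> P" "0 \<le> Q"
  shows "(p + q)\<^sup>2 \<le> (a + b) * (P + Q)"
proof -
  have "(p * q)\<^sup>2 \<le> (a * P) * (b * Q)"
    using assms by (simp only: power_mult_distrib) (intro mult_mono; simp)
  also have "\<dots> \<le> ((a * Q + b * P) / 2)\<^sup>2"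
    using zero_le_power2[of "a * Q - b * P"] by (simp add: power2_eq_square field_simps)
  finally have "\<bar>p * q\<bar> \<le> \<bar>(a * Q + b * P) / 2\<bar>"
    by (simp only: abs_le_square_iff)
  then have "2 * (p * q) \<le> a * Q + b * P" using assms by simp
  then show ?thesis using assms(1,2) by (simp add: power2_sum algebra_simps)
qed

lemma integral_square_nonneg: "0 \<le> integral {a..b::real} (\<lambda>x. (g x)\<^sup>2 :: real)"
  by (cases "(\<lambda>x. (g x)\<^sup>2) integrable_on {a..b}") (auto simp: integral_nonneg not_integrable_integral)

text \<open>The energy along the broken line from \<open>(t, 0)\<close> to \<open>(t, t)\<close> to \<open>(h, t)\<close>, whose length is \<open>h\<close>.\<close>

definition bent_energy :: "real \<Rightarrow> (real \<times> real \<Rightarrow> real) \<Rightarrow> (real \<times> real \<Rightarrow> real) \<Rightarrow> real \<Rightarrow> real" where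
  "bent_energy h w1 w2 t = integral {t..h} (\<lambda>x. (w1 (x, t))\<^sup>2) + integral {0..t} (\<lambda>y. (w2 (t, y))\<^sup>2)"

text \<open>The symmetry makes the sums over paired points in \<open>triangle_rows\<close> and \<open>triangle_columns\<close> twice the value
  at one point; hence the division by 2.\<close>

lemma bent_energy_integrable:
  assumes "0 < h" "continuous_on UNIV p" "continuous_on UNIV q"
    and "\<And>x y. (p (x, - y))\<^sup>2 = (p (x, y))\<^sup>2" "\<And>x y. (q (x, - y))\<^sup>2 = (q (x, y))\<^sup>2"
  shows "bent_energy h p q integrable_on {0..h}"
proof -
  have "continuous_on UNIV (\<lambda>z. (p z)\<^sup>2 / 2)" "continuous_on UNIV (\<lambda>z. (q z)\<^sup>2 / 2)"
    by (auto intro!: continuous_intros assms)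
  from has_integral_add[OF triangle_rows[OF assms(1) this(1)] triangle_columns[OF assms(1) this(2)]]
  show ?thesis
    unfolding bent_energy_def assms by (auto simp: integrable_on_def)
qed

text \<open>The estimate for odd functions: the broken line starts where \<open>w\<close> vanishes.\<close>

lemma square_le_bent_energy:
  assumes w: "C1_partials w w1 w2" and z: "\<And>x. w (x, 0) = 0" and t: "0 \<le> t" "t \<le> h"
  shows "(w (h, t))\<^sup>2 \<le> h * bent_energy h w1 w2 t"
proof -
  have "((w (h, t) - w (t, t)) + (w (t, t) - w (t, 0)))\<^sup>2 \<le>
     ((h - t) + (t - 0)) * bent_energy h w1 w2 t"
    unfolding bent_energy_def using t
    by (intro power2_sum_le horizontal_increment[OF w] vertical_increment[OF w] integral_square_nonneg) auto
  then show ?thesis by (simp add: z)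
qed

text \<open>The path between the two points of the hypotenuse leaves broken line \<open>t\<close> at \<open>(t, s)\<close> for broken line \<open>s\<close>.\<close>

lemma square_difference_le_bent_energies:
  assumes w: "C1_partials w w1 w2" and st: "0 \<le> s" "s \<le> t" "t \<le> h"
  shows "(w (h, t) - w (h, s))\<^sup>2 \<le>
     2 * (h - s) * bent_energy h w1 w2 t + 2 * (h - t) * bent_energy h w1 w2 s"
proof -
  let ?V = "\<lambda>a. integral {a..t} (\<lambda>y. (w2 (t, y))\<^sup>2)"
  let ?H = "\<lambda>a. integral {a..h} (\<lambda>x. (w1 (x, s))\<^sup>2)"
  have c: "continuous_on UNIV w1" "continuous_on UNIV w2"
    using w by (auto simp: C1_partials_def)
  have "((w (h, t) - w (t, t)) + (w (t, t) - w (t, s)))\<^sup>2 \<le>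
     ((h - t) + (t - s)) * (integral {t..h} (\<lambda>x. (w1 (x, t))\<^sup>2) + ?V s)"
    using st by (intro power2_sum_le horizontal_increment[OF w] vertical_increment[OF w]
        integral_square_nonneg) auto
  also have "\<dots> \<le> (h - s) * bent_energy h w1 w2 t"
  proof -
    have "?V s \<le> ?V 0" using st
      by (intro integral_subset_le integrable_continuous_real continuous_intros continuous_on_column c) auto
    then show ?thesis unfolding bent_energy_def using st by (auto intro!: mult_left_mono)
  qed
  finally have 1: "(w (h, t) - w (t, s))\<^sup>2 \<le> (h - s) * bent_energy h w1 w2 t" by simp
  have "(w (h, s) - w (t, s))\<^sup>2 \<le> (h - t) * ?H t"
    using st by (intro horizontal_increment[OF w])
  also have "\<dots> \<le> (h - t) * bent_energy h w1 w2 s"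
  proof -
    have "?H t \<le> ?H s" using st
      by (intro integral_subset_le integrable_continuous_real continuous_intros continuous_on_row c) auto
    then show ?thesis unfolding bent_energy_def using st integral_square_nonneg
      by (auto intro!: mult_left_mono add_increasing2)
  qed
  finally have 2: "(w (h, s) - w (t, s))\<^sup>2 \<le> (h - t) * bent_energy h w1 w2 s" .
  have "(w (h, t) - w (h, s))\<^sup>2 \<le> 2 * (w (h, t) - w (t, s))\<^sup>2 + 2 * (w (h, s) - w (t, s))\<^sup>2"
    using zero_le_power2[of "w (h, t) + w (h, s) - 2 * w (t, s)"]
    by (simp add: power2_eq_square algebra_simps)
  with 1 2 show ?thesis by (simp add: algebra_simps)
qed

text \<open>Integrating \<open>(f t - f s)\<^sup>2\<close> over both variables gives \<open>2 * h * \<integral>f\<^sup>2 - 2 * (\<integral>f)\<^sup>2\<close>, and the right-hand side of the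
  hypothesis gives \<open>2 * h\<^sup>2 * E\<close>. The hypothesis is asked only for \<open>s \<le> t\<close> because it is symmetric.\<close>

lemma mean_square_deviation_le:
  fixes f A :: "real \<Rightarrow> real"
  assumes "0 < h" "continuous_on UNIV f" "(A has_integral E) {0..h}"
    and le: "\<And>s t. 0 \<le> s \<Longrightarrow> s \<le> t \<Longrightarrow> t \<le> h \<Longrightarrow>
          (f t - f s)\<^sup>2 \<le> 2 * (h - s) * A t + 2 * (h - t) * A s"
  shows "integral {0..h} (\<lambda>t. (f t)\<^sup>2) - (integral {0..h} f)\<^sup>2 / h \<le> h * E"
proof -
  define F where "F = integral {0..h} f"
  define G where "G = integral {0..h} (\<lambda>t. (f t)\<^sup>2)"
  have c: "continuous_on {0..h} f" using assms(2) continuous_on_subset by blast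
  have iF: "(f has_integral F) {0..h}"
    unfolding F_def by (intro integrable_integral integrable_continuous_real c)
  have iG: "((\<lambda>t. (f t)\<^sup>2) has_integral G) {0..h}"
    unfolding G_def by (intro integrable_integral integrable_continuous_real continuous_intros c)
  have const: "((\<lambda>s. k) has_integral h * k) {0..h}" for k :: real
    using has_integral_const_real[of k 0 h] assms(1) by simp
  have lin: "((\<lambda>s. h - s) has_integral h\<^sup>2 / 2) {0..h}"
  proof -
    have "((\<lambda>s. h - s) has_integral ((h * h - h\<^sup>2 / 2) - (h * 0 - 0\<^sup>2 / 2))) {0..h}"
      using assms(1) by (intro fundamental_theorem_of_calculus)
        (auto intro!: derivative_eq_intros simp: has_real_derivative_iff_has_vector_derivative[symmetric])
    then show ?thesis by (simp add: power2_eq_square)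
  qed
  have all: "(f t - f s)\<^sup>2 \<le> 2 * (h - s) * A t + 2 * (h - t) * A s" if "s \<in> {0..h}" "t \<in> {0..h}" for s t
    using le[of s t] le[of t s] that by (cases "s \<le> t") (auto simp: power2_commute[of "f t"])
  have inner: "h * (f t)\<^sup>2 - 2 * f t * F + G \<le> h\<^sup>2 * A t + 2 * (h - t) * E" if t: "t \<in> {0..h}" for t
  proof (rule has_integral_le)
    show "((\<lambda>s. (f t)\<^sup>2 - (2 * f t) * f s + (f s)\<^sup>2) has_integral h * (f t)\<^sup>2 - 2 * f t * F + G) {0..h}"
      by (intro has_integral_add has_integral_diff has_integral_mult_right const iF iG)
    have "((\<lambda>s. (2 * A t) * (h - s) + (2 * (h - t)) * A s) has_integral
        (2 * A t) * (h\<^sup>2 / 2) + (2 * (h - t)) * E) {0..h}"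
      by (intro has_integral_add has_integral_mult_right lin assms(3))
    then show "((\<lambda>s. (2 * A t) * (h - s) + (2 * (h - t)) * A s) has_integral h\<^sup>2 * A t + 2 * (h - t) * E) {0..h}"
      by (simp add: algebra_simps)
    show "(f t)\<^sup>2 - (2 * f t) * f s + (f s)\<^sup>2 \<le> (2 * A t) * (h - s) + (2 * (h - t)) * A s"
      if "s \<in> {0..h}" for s
      using all[OF that t] by (simp add: power2_diff algebra_simps)
  qed
  have "h * G - (2 * F) * F + h * G \<le> h\<^sup>2 * E + (2 * E) * (h\<^sup>2 / 2)"
  proof (rule has_integral_le)
    show "((\<lambda>t. h * (f t)\<^sup>2 - (2 * F) * f t + G) has_integral h * G - (2 * F) * F + h * G) {0..h}"
      by (intro has_integral_add has_integral_diff has_integral_mult_right const iF iG)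
    show "((\<lambda>t. h\<^sup>2 * A t + (2 * E) * (h - t)) has_integral h\<^sup>2 * E + (2 * E) * (h\<^sup>2 / 2)) {0..h}"
      by (intro has_integral_add has_integral_mult_right lin assms(3))
    show "h * (f t)\<^sup>2 - (2 * F) * f t + G \<le> h\<^sup>2 * A t + (2 * E) * (h - t)" if "t \<in> {0..h}" for t
      using inner[OF that] by (simp add: algebra_simps)
  qed
  then have "h * (G - F\<^sup>2 / h) \<le> h * (h * E)"
    using assms(1) by (simp add: power2_eq_square algebra_simps)
  then show ?thesis using assms(1) unfolding F_def G_def by simp
qed

text \<open>The even part is controlled up to its mean, and the odd part in full. The factor 2 in \<open>energy\<close> is
  the passage from the half triangle to the whole one.\<close>

lemma C1_trace_inequality:
  assumes h: "0 < h" and w: "C1_partials w w1 w2"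
  shows "integral {-h..h} (\<lambda>t. (w (h, t))\<^sup>2) - (integral {-h..h} (\<lambda>t. w (h, t)))\<^sup>2 / (2 * h)
    \<le> h * ((\<integral>z. (w1 z)\<^sup>2 \<partial>lebesgue_on (right_triangle h)) +
           (\<integral>z. (w2 z)\<^sup>2 \<partial>lebesgue_on (right_triangle h)))"
proof -
  \<comment> \<open>Even and odd parts. Reflection reverses the sign of the derivative in \<open>y\<close>.\<close>
  let ?e = "\<lambda>p. 1/2 * w p + 1/2 * w (fst p, - snd p)"
  let ?e1 = "\<lambda>p. 1/2 * w1 p + 1/2 * w1 (fst p, - snd p)"
  let ?e2 = "\<lambda>p. 1/2 * w2 p + 1/2 * - w2 (fst p, - snd p)"
  let ?o = "\<lambda>p. 1/2 * w p + (-1/2) * w (fst p, - snd p)"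
  let ?o1 = "\<lambda>p. 1/2 * w1 p + (-1/2) * w1 (fst p, - snd p)"
  let ?o2 = "\<lambda>p. 1/2 * w2 p + (-1/2) * - w2 (fst p, - snd p)"
  have e: "C1_partials ?e ?e1 ?e2" and o: "C1_partials ?o ?o1 ?o2"
    using C1_partials_linear[OF w C1_partials_reflect[OF w], of "1/2" "1/2"]
      C1_partials_linear[OF w C1_partials_reflect[OF w], of "1/2" "-1/2"] by auto
  have cw: "continuous_on UNIV w" "continuous_on UNIV w1" "continuous_on UNIV w2"
    using C1_partials_continuous[OF w] .
  have Ae: "bent_energy h ?e1 ?e2 integrable_on {0..h}"
    using C1_partials_continuous[OF e] h by (intro bent_energy_integrable) (auto simp: power2_eq_square algebra_simps)
  have Ao: "bent_energy h ?o1 ?o2 integrable_on {0..h}"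
    using C1_partials_continuous[OF o] h by (intro bent_energy_integrable) (auto simp: power2_eq_square algebra_simps)
  let ?Ee = "integral {0..h} (bent_energy h ?e1 ?e2)"
  let ?Eo = "integral {0..h} (bent_energy h ?o1 ?o2)"
  let ?E = "(\<integral>z. (w1 z)\<^sup>2 \<partial>lebesgue_on (right_triangle h)) + (\<integral>z. (w2 z)\<^sup>2 \<partial>lebesgue_on (right_triangle h))"
  \<comment> \<open>In the sum of the squares of the even and odd parts the mixed terms cancel pointwise.\<close>
  have energy: "2 * (?Ee + ?Eo) = ?E"
  proof -
    have "2 * (bent_energy h ?e1 ?e2 t + bent_energy h ?o1 ?o2 t) =
        integral {t..h} (\<lambda>x. (w1 (x, t))\<^sup>2 + (w1 (x, -t))\<^sup>2) +
        integral {0..t} (\<lambda>y. (w2 (t, y))\<^sup>2 + (w2 (t, -y))\<^sup>2)" for t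
    proof -
      have "integral {t..h} (\<lambda>x. (?e1 (x, t))\<^sup>2) + integral {t..h} (\<lambda>x. (?o1 (x, t))\<^sup>2) =
          integral {t..h} (\<lambda>x. ((w1 (x, t))\<^sup>2 + (w1 (x, -t))\<^sup>2) / 2)"
      proof -
        have "integral {t..h} (\<lambda>x. (?e1 (x, t))\<^sup>2) + integral {t..h} (\<lambda>x. (?o1 (x, t))\<^sup>2) =
            integral {t..h} (\<lambda>x. (?e1 (x, t))\<^sup>2 + (?o1 (x, t))\<^sup>2)"
          by (rule integral_add[symmetric])
            (auto intro!: integrable_continuous_real continuous_intros continuous_on_row cw)
        also have "\<dots> = integral {t..h} (\<lambda>x. ((w1 (x, t))\<^sup>2 + (w1 (x, -t))\<^sup>2) / 2)"
          by (rule integral_cong) (simp add: power2_eq_square field_simps)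
        finally show ?thesis .
      qed
      moreover have "integral {0..t} (\<lambda>y. (?e2 (t, y))\<^sup>2) + integral {0..t} (\<lambda>y. (?o2 (t, y))\<^sup>2) =
          integral {0..t} (\<lambda>y. ((w2 (t, y))\<^sup>2 + (w2 (t, -y))\<^sup>2) / 2)"
      proof -
        have "integral {0..t} (\<lambda>y. (?e2 (t, y))\<^sup>2) + integral {0..t} (\<lambda>y. (?o2 (t, y))\<^sup>2) =
            integral {0..t} (\<lambda>y. (?e2 (t, y))\<^sup>2 + (?o2 (t, y))\<^sup>2)"
          by (rule integral_add[symmetric])
            (auto intro!: integrable_continuous_real continuous_intros continuous_on_column cw
               continuous_on_compose2[OF cw(3)])
        also have "\<dots> = integral {0..t} (\<lambda>y. ((w2 (t, y))\<^sup>2 + (w2 (t, -y))\<^sup>2) / 2)"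
          by (rule integral_cong) (simp add: power2_eq_square field_simps)
        finally show ?thesis .
      qed
      ultimately show ?thesis by (simp add: bent_energy_def)
    qed
    moreover have "((\<lambda>t. integral {t..h} (\<lambda>x. (w1 (x, t))\<^sup>2 + (w1 (x, -t))\<^sup>2) +
        integral {0..t} (\<lambda>y. (w2 (t, y))\<^sup>2 + (w2 (t, -y))\<^sup>2)) has_integral ?E) {0..h}"
      by (intro has_integral_add triangle_rows triangle_columns h continuous_intros cw)
    ultimately have "((\<lambda>t. 2 * (bent_energy h ?e1 ?e2 t + bent_energy h ?o1 ?o2 t)) has_integral ?E) {0..h}"
      by simp
    moreover have "((\<lambda>t. 2 * (bent_energy h ?e1 ?e2 t + bent_energy h ?o1 ?o2 t)) has_integral 2 * (?Ee + ?Eo)) {0..h}"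
      by (intro has_integral_mult_right has_integral_add integrable_integral Ae Ao)
    ultimately show ?thesis using has_integral_unique by blast
  qed
  have even: "integral {0..h} (\<lambda>t. (?e (h, t))\<^sup>2) - (integral {0..h} (\<lambda>t. ?e (h, t)))\<^sup>2 / h \<le> h * ?Ee"
  proof (rule mean_square_deviation_le[OF h])
    show "continuous_on UNIV (\<lambda>t. ?e (h, t))"
      by (rule continuous_on_column[OF C1_partials_continuous(1)[OF e]])
    show "(bent_energy h ?e1 ?e2 has_integral ?Ee) {0..h}"
      by (rule integrable_integral[OF Ae])
    show "(?e (h, t) - ?e (h, s))\<^sup>2 \<le> 2 * (h - s) * bent_energy h ?e1 ?e2 t + 2 * (h - t) * bent_energy h ?e1 ?e2 s"
      if "0 \<le> s" "s \<le> t" "t \<le> h" for s t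
      by (rule square_difference_le_bent_energies[OF e that])
  qed
  have odd: "integral {0..h} (\<lambda>t. (?o (h, t))\<^sup>2) \<le> h * ?Eo"
  proof -
    have "integral {0..h} (\<lambda>t. (?o (h, t))\<^sup>2) \<le> integral {0..h} (\<lambda>t. h * bent_energy h ?o1 ?o2 t)"
    proof (rule integral_le)
      show "(\<lambda>t. (?o (h, t))\<^sup>2) integrable_on {0..h}"
        by (intro integrable_continuous_real continuous_on_power continuous_on_column[OF C1_partials_continuous(1)[OF o]])
      show "(\<lambda>t. h * bent_energy h ?o1 ?o2 t) integrable_on {0..h}"
        by (rule integrable_on_mult_right[OF Ao])
      show "(?o (h, t))\<^sup>2 \<le> h * bent_energy h ?o1 ?o2 t" if "t \<in> {0..h}" for t
        by (rule square_le_bent_energy[OF o]) (use that in auto)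
    qed
    then show ?thesis by simp
  qed
  have mean: "integral {-h..h} (\<lambda>t. w (h, t)) = 2 * integral {0..h} (\<lambda>t. ?e (h, t))"
    using h by (subst integral_symmetrize) (auto intro!: continuous_on_column cw simp flip: integral_mult_right)
  have "integral {-h..h} (\<lambda>t. (w (h, t))\<^sup>2) = integral {0..h} (\<lambda>t. 2 * (?e (h, t))\<^sup>2 + 2 * (?o (h, t))\<^sup>2)"
  proof -
    have "integral {-h..h} (\<lambda>t. (w (h, t))\<^sup>2) = integral {0..h} (\<lambda>t. (w (h, t))\<^sup>2 + (w (h, -t))\<^sup>2)"
      using h by (intro integral_symmetrize) (auto intro!: continuous_on_column cw continuous_intros)
    also have "\<dots> = integral {0..h} (\<lambda>t. 2 * (?e (h, t))\<^sup>2 + 2 * (?o (h, t))\<^sup>2)"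
      by (rule integral_cong) (simp add: power2_eq_square field_simps)
    finally show ?thesis .
  qed
  also have "\<dots> = 2 * integral {0..h} (\<lambda>t. (?e (h, t))\<^sup>2) + 2 * integral {0..h} (\<lambda>t. (?o (h, t))\<^sup>2)"
  proof -
    have "(\<lambda>t. 2 * (?e (h, t))\<^sup>2) integrable_on {0..h}" "(\<lambda>t. 2 * (?o (h, t))\<^sup>2) integrable_on {0..h}"
      by (intro integrable_continuous_real continuous_intros continuous_on_column[OF C1_partials_continuous(1)[OF e]]
          continuous_on_column[OF C1_partials_continuous(1)[OF o]])+
    from integral_add[OF this] show ?thesis by simp
  qed
  finally have square: "integral {-h..h} (\<lambda>t. (w (h, t))\<^sup>2) =
     2 * integral {0..h} (\<lambda>t. (?e (h, t))\<^sup>2) + 2 * integral {0..h} (\<lambda>t. (?o (h, t))\<^sup>2)" .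
  have "h * ?E = 2 * (h * ?Ee) + 2 * (h * ?Eo)" by (simp add: energy[symmetric] algebra_simps)
  moreover have "(2 * X)\<^sup>2 / (2 * h) = 2 * (X\<^sup>2 / h)" for X :: real
    by (simp add: power2_eq_square)
  ultimately show ?thesis unfolding mean square using even odd by simp
qed


section \<open>Traces of Sobolev functions\<close>

abbreviation hyp_measure :: "real \<Rightarrow> (real \<times> real) measure" where
  "hyp_measure h \<equiv> length_on_line h (hypotenuse h)"

lemma hyp_measure_eq_embed:
  "hyp_measure h = embed_measure (lebesgue_on {-h..h}) (\<lambda>t. (h, t))"
proof -
  have "{t. (h, t) \<in> hypotenuse h} = {-h..h}" by (auto simp: hypotenuse_def)
  then show ?thesis by (simp add: length_on_line_def)
qed

lemma hyp_measure_distr: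
  "hyp_measure h = distr (lebesgue_on {-h..h}) (hyp_measure h) (\<lambda>t. (h, t))"
  "(\<lambda>t. (h, t)) \<in> measurable (lebesgue_on {-h..h}) (hyp_measure h)"
proof -
  note e = hyp_measure_eq_embed
  have i: "inj (\<lambda>t::real. (h, t))" by (auto simp: inj_on_def)
  show "hyp_measure h = distr (lebesgue_on {-h..h}) (hyp_measure h) (\<lambda>t. (h, t))"
    unfolding e by (rule embed_measure_eq_distr[OF i])
  show "(\<lambda>t. (h, t)) \<in> measurable (lebesgue_on {-h..h}) (hyp_measure h)"
    unfolding e by (rule measurable_embed_measure2[OF i])
qed

lemma borel_measurable_hyp_measure:
  assumes "continuous_on UNIV F"
  shows "F \<in> borel_measurable (hyp_measure h)"
proof -
  note e = hyp_measure_eq_embed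
  have "continuous_on UNIV (\<lambda>t. F (h, t))"
    by (rule continuous_on_compose2[OF assms]) (auto intro!: continuous_intros)
  then have "(\<lambda>t. F (h, t)) \<in> borel_measurable (lebesgue_on {-h..h})"
    by (intro measurable_restrict_space1 measurable_completion) (simp add: borel_measurable_continuous_onI)
  then show ?thesis
    unfolding e by (intro measurable_embed_measure1) simp
qed

lemma integral_hyp_measure:
  fixes F :: "real \<times> real \<Rightarrow> real"
  assumes "continuous_on UNIV F"
  shows "integrable (hyp_measure h) F"
    and "(\<integral>z. F z \<partial>hyp_measure h) = integral {-h..h} (\<lambda>t. F (h, t))"
proof -
  have c: "continuous_on UNIV (\<lambda>t. F (h, t))"
    by (rule continuous_on_compose2[OF assms]) (auto intro!: continuous_intros)
  have i: "integrable (lebesgue_on {-h..h}) (\<lambda>t. F (h, t))"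
    by (rule integrable_continuous_bounded[OF c, of _ "-h" h]) auto
  show "integrable (hyp_measure h) F"
    by (subst hyp_measure_distr(1), subst integrable_distr_eq)
      (auto intro: hyp_measure_distr borel_measurable_hyp_measure assms i)
  have "(\<integral>z. F z \<partial>hyp_measure h) = (\<integral>t. F (h, t) \<partial>lebesgue_on {-h..h})"
    by (subst hyp_measure_distr(1), subst integral_distr)
      (auto intro: hyp_measure_distr borel_measurable_hyp_measure assms)
  also have "\<dots> = integral {-h..h} (\<lambda>t. F (h, t))"
    using has_integral_integral_lebesgue_on[OF i] by (simp add: integral_unique)
  finally show "(\<integral>z. F z \<partial>hyp_measure h) = integral {-h..h} (\<lambda>t. F (h, t))" .
qed

lemma L2_hyp_measure:
  fixes F :: "real \<times> real \<Rightarrow> real"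
  shows "continuous_on UNIV F \<Longrightarrow> F \<in> L2 (hyp_measure h)"
  unfolding L2_def
  by (auto intro!: borel_measurable_hyp_measure integral_hyp_measure continuous_intros)

lemma smooth_trace_inequality:
  assumes "0 < h" "smooth \<phi>"
  shows "(\<integral>z. (norm (\<phi> z))\<^sup>2 \<partial>hyp_measure h) - (\<integral>z. \<phi> z \<partial>hyp_measure h)\<^sup>2 / (2 * h)
    \<le> h * (\<integral>z. (norm (gradient \<phi> z))\<^sup>2 \<partial>lebesgue_on (right_triangle h))"
proof -
  note c = smooth_continuous[OF assms(2)] continuous_gradient[OF assms(2)]
  have "(\<integral>z. (norm (gradient \<phi> z))\<^sup>2 \<partial>lebesgue_on (right_triangle h)) =
      (\<integral>z. (fst (gradient \<phi> z))\<^sup>2 + (snd (gradient \<phi> z))\<^sup>2 \<partial>lebesgue_on (right_triangle h))"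
    by (simp add: norm_prod_def)
  also have "\<dots> = (\<integral>z. (fst (gradient \<phi> z))\<^sup>2 \<partial>lebesgue_on (right_triangle h)) +
      (\<integral>z. (snd (gradient \<phi> z))\<^sup>2 \<partial>lebesgue_on (right_triangle h))"
    by (intro Bochner_Integration.integral_add integrable_triangle continuous_intros c)
  finally show ?thesis
    using C1_trace_inequality[OF assms(1) smooth_C1_partials[OF assms(2)]] c(1)
    by (simp add: integral_hyp_measure continuous_intros)
qed

text \<open>All terms are inner products with a fixed \<open>L2\<close> function, the shape in which \<open>L2_converges_inner\<close> takes
  the limit.\<close>

lemma smooth_trace_mean:
  assumes "0 < h" "smooth \<phi>"
  shows "h * (\<integral>z. 1 \<bullet> \<phi> z \<partial>hyp_measure h) =
     (\<integral>z. 2 \<bullet> \<phi> z \<partial>lebesgue_on (right_triangle h)) + (\<integral>z. z \<bullet> gradient \<phi> z \<partial>lebesgue_on (right_triangle h))"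
proof -
  note c = smooth_continuous[OF assms(2)] continuous_gradient[OF assms(2)]
  have "(\<integral>z. 2 * \<phi> z + (fst z * fst (gradient \<phi> z) + snd z * snd (gradient \<phi> z)) \<partial>lebesgue_on (right_triangle h)) =
      (\<integral>z. 2 * \<phi> z \<partial>lebesgue_on (right_triangle h)) +
      (\<integral>z. fst z * fst (gradient \<phi> z) + snd z * snd (gradient \<phi> z) \<partial>lebesgue_on (right_triangle h))"
    by (intro Bochner_Integration.integral_add integrable_triangle continuous_intros c)
  then show ?thesis
    using C1_trace_mean[OF assms(1) smooth_C1_partials[OF assms(2)]] c(1)
    by (simp add: integral_hyp_measure inner_prod_def)
qed

text \<open>By uniqueness of the weak gradient, the approximating gradients converge to any prescribed representative.\<close>

lemma has_trace_weak_gradient: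
  assumes "has_trace (right_triangle h) \<sigma> w g"
    and v: "v \<in> L2 (lebesgue_on (right_triangle h))" "has_weak_gradient (right_triangle h) w v"
  obtains \<phi> where "\<And>n. smooth (\<phi> n)" "L2_converges (lebesgue_on (right_triangle h)) \<phi> w"
    "L2_converges (lebesgue_on (right_triangle h)) (\<lambda>n. gradient (\<phi> n)) v" "L2_converges \<sigma> \<phi> g"
proof -
  let ?L = "lebesgue_on (right_triangle h)"
  obtain v' \<phi> where v': "has_weak_gradient (right_triangle h) w v'" "\<And>n. smooth (\<phi> n)"
    "L2_converges ?L \<phi> w" "L2_converges ?L (\<lambda>n. gradient (\<phi> n)) v'" "L2_converges \<sigma> \<phi> g"
    using assms(1) by (auto simp: has_trace_def)
  have L: "v' \<in> L2 ?L" and G: "gradient (\<phi> n) \<in> L2 ?L" for n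
    using v'(4) by (auto simp: L2_converges_def)
  have ae: "AE x in ?L. v' x = v x"
    using weak_gradient_unique[OF open_right_triangle right_triangle_subset_cbox L v'(1) v] .
  have "L2_norm ?L (\<lambda>x. gradient (\<phi> n) x - v x) = L2_norm ?L (\<lambda>x. gradient (\<phi> n) x - v' x)" for n
    unfolding L2_norm_def using ae L2_D(1)[OF G[of n]] L2_D(1)[OF v(1)] L2_D(1)[OF L]
    by (intro arg_cong[where f = sqrt] integral_cong_AE borel_measurable_power borel_measurable_norm
        borel_measurable_diff) auto
  then have "L2_converges ?L (\<lambda>n. gradient (\<phi> n)) v"
    using v'(4) v(1) by (simp add: L2_converges_def)
  with v' that show ?thesis by blast
qed

text \<open>The right-hand side does not mention \<open>g\<close>. So all traces of \<open>w\<close> have the same mean, and it is enough that one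
  of them has mean zero.\<close>

lemma trace_mean_eq:
  assumes h: "0 < h" and t: "has_trace (right_triangle h) (hyp_measure h) w g"
    and v: "v \<in> L2 (lebesgue_on (right_triangle h))" "has_weak_gradient (right_triangle h) w v"
  shows "h * (\<integral>z. g z \<partial>hyp_measure h) =
     (\<integral>z. 2 * w z \<partial>lebesgue_on (right_triangle h)) + (\<integral>z. z \<bullet> v z \<partial>lebesgue_on (right_triangle h))"
proof -
  let ?L = "lebesgue_on (right_triangle h)"
  obtain \<phi> where \<phi>: "\<And>n. smooth (\<phi> n)" "L2_converges ?L \<phi> w"
    "L2_converges ?L (\<lambda>n. gradient (\<phi> n)) v" "L2_converges (hyp_measure h) \<phi> g"
    using has_trace_weak_gradient[OF t v] by blast
  have "(\<lambda>n. h * (\<integral>z. 1 \<bullet> \<phi> n z \<partial>hyp_measure h)) \<longlonglongrightarrow> h * (\<integral>z. 1 \<bullet> g z \<partial>hyp_measure h)"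
    by (intro tendsto_intros L2_converges_inner[OF \<phi>(4)] L2_hyp_measure) simp
  moreover have "(\<lambda>n. h * (\<integral>z. 1 \<bullet> \<phi> n z \<partial>hyp_measure h)) \<longlonglongrightarrow>
      (\<integral>z. 2 \<bullet> w z \<partial>?L) + (\<integral>z. z \<bullet> v z \<partial>?L)"
    unfolding smooth_trace_mean[OF h \<phi>(1)]
    by (intro tendsto_intros L2_converges_inner[OF \<phi>(2)] L2_converges_inner[OF \<phi>(3)] L2_triangle) auto
  ultimately show ?thesis using LIMSEQ_unique by fastforce
qed

lemma trace_square_le:
  assumes h: "0 < h" and t: "has_trace (right_triangle h) (hyp_measure h) w g"
    and v: "v \<in> L2 (lebesgue_on (right_triangle h))" "has_weak_gradient (right_triangle h) w v"
  shows "(\<integral>z. (norm (g z))\<^sup>2 \<partial>hyp_measure h) - (\<integral>z. g z \<partial>hyp_measure h)\<^sup>2 / (2 * h)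
    \<le> h * (\<integral>z. (norm (v z))\<^sup>2 \<partial>lebesgue_on (right_triangle h))"
proof -
  let ?L = "lebesgue_on (right_triangle h)"
  obtain \<phi> where \<phi>: "\<And>n. smooth (\<phi> n)" "L2_converges ?L \<phi> w"
    "L2_converges ?L (\<lambda>n. gradient (\<phi> n)) v" "L2_converges (hyp_measure h) \<phi> g"
    using has_trace_weak_gradient[OF t v] by blast
  have "(\<lambda>n. \<integral>z. 1 \<bullet> \<phi> n z \<partial>hyp_measure h) \<longlonglongrightarrow> (\<integral>z. 1 \<bullet> g z \<partial>hyp_measure h)"
    by (intro L2_converges_inner[OF \<phi>(4)] L2_hyp_measure) simp
  then have mean: "(\<lambda>n. \<integral>z. \<phi> n z \<partial>hyp_measure h) \<longlonglongrightarrow> (\<integral>z. g z \<partial>hyp_measure h)" by simp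
  show ?thesis
  proof (rule LIMSEQ_le)
    show "(\<lambda>n. (\<integral>z. (norm (\<phi> n z))\<^sup>2 \<partial>hyp_measure h) - (\<integral>z. \<phi> n z \<partial>hyp_measure h)\<^sup>2 / (2 * h))
        \<longlonglongrightarrow> (\<integral>z. (norm (g z))\<^sup>2 \<partial>hyp_measure h) - (\<integral>z. g z \<partial>hyp_measure h)\<^sup>2 / (2 * h)"
      using h by (intro tendsto_intros L2_converges_square[OF \<phi>(4)] mean) auto
    show "(\<lambda>n. h * (\<integral>z. (norm (gradient (\<phi> n) z))\<^sup>2 \<partial>?L)) \<longlonglongrightarrow> h * (\<integral>z. (norm (v z))\<^sup>2 \<partial>?L)"
      by (intro tendsto_intros L2_converges_square[OF \<phi>(3)])
    show "\<exists>N. \<forall>n\<ge>N. (\<integral>z. (norm (\<phi> n z))\<^sup>2 \<partial>hyp_measure h) - (\<integral>z. \<phi> n z \<partial>hyp_measure h)\<^sup>2 / (2 * h)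
        \<le> h * (\<integral>z. (norm (gradient (\<phi> n) z))\<^sup>2 \<partial>?L)"
      using smooth_trace_inequality[OF h \<phi>(1)] by blast
  qed
qed

lemma trace_inequality_hypotenuse:
  assumes h: "0 < h"
  shows "trace_inequality (right_triangle h) (hyp_measure h) (sqrt h)"
  unfolding trace_inequality_def
proof (intro ballI allI impI)
  fix w g v
  assume w: "w \<in> H1_tilde (right_triangle h) (hyp_measure h)"
    and t: "has_trace (right_triangle h) (hyp_measure h) w g"
    and v: "v \<in> L2 (lebesgue_on (right_triangle h))" "has_weak_gradient (right_triangle h) w v"
  obtain g' where g': "has_trace (right_triangle h) (hyp_measure h) w g'" "mean_value (hyp_measure h) g' = 0"
    using w by (auto simp: H1_tilde_def)
  have "space (hyp_measure h) = hypotenuse h"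
    by (intro space_length_on_line) (auto simp: hypotenuse_def)
  then have "measure (hyp_measure h) (space (hyp_measure h)) = 2 * h"
    using emeasure_length_on_hypotenuse[OF h] h by (simp add: measure_def)
  then have "(\<integral>z. g' z \<partial>hyp_measure h) = 0"
    using g'(2) h by (simp add: mean_value_def)
  moreover have "h * (\<integral>z. g' z \<partial>hyp_measure h) = h * (\<integral>z. g z \<partial>hyp_measure h)"
    using trace_mean_eq[OF h g'(1) v] trace_mean_eq[OF h t v] by simp
  ultimately have "(\<integral>z. g z \<partial>hyp_measure h) = 0" using h by simp
  then show "L2_norm (hyp_measure h) g \<le> sqrt h * L2_norm (lebesgue_on (right_triangle h)) v"
    using trace_square_le[OF h t v] by (simp add: L2_norm_def flip: real_sqrt_mult)
qed


section \<open>The extremal function\<close>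

text \<open>Integration by parts: the product of \<open>u\<close> with a test function vanishes on the boundary.\<close>

lemma smooth_has_weak_gradient:
  assumes h: "0 < h" and u: "smooth u"
  shows "has_weak_gradient (right_triangle h) u (gradient u)"
  unfolding has_weak_gradient_def
proof (intro allI impI ballI)
  fix \<phi> and b :: "real \<times> real" assume \<phi>: "test_function (right_triangle h) \<phi>" and b: "b \<in> Basis"
  let ?L = "lebesgue_on (right_triangle h)"
  have s: "smooth \<phi>" using \<phi> by (simp add: test_function_def)
  have su: "smooth (\<lambda>z. u z * \<phi> z)" by (rule smooth_mult[OF u s])
  have "u z * \<phi> z = 0" if "z \<notin> right_triangle h" for z
    using that \<phi> closure_subset[of "{x. \<phi> x \<noteq> 0}"] by (auto simp: test_function_def)
  note zero = integral_partials_eq_0[OF h smooth_C1_partials[OF su] this]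
  have "(\<integral>z. gradient (\<lambda>z. u z * \<phi> z) z \<bullet> b \<partial>?L) = 0"
    using b zero by (auto simp: Basis_prod_def inner_prod_def)
  moreover have "(\<integral>z. gradient (\<lambda>z. u z * \<phi> z) z \<bullet> b \<partial>?L) =
      (\<integral>z. u z * (gradient \<phi> z \<bullet> b) + (gradient u z \<bullet> b) * \<phi> z \<partial>?L)"
    unfolding gradient_mult[OF u s] by (simp add: inner_add_left) (simp add: mult.commute)
  moreover have "\<dots> = (\<integral>z. u z * (gradient \<phi> z \<bullet> b) \<partial>?L) + (\<integral>z. (gradient u z \<bullet> b) * \<phi> z \<partial>?L)"
    by (intro Bochner_Integration.integral_add integrable_triangle continuous_intros
        smooth_continuous continuous_gradient u s)
  ultimately show "(\<integral>z. u z * (gradient \<phi> z \<bullet> b) \<partial>?L) = - (\<integral>z. (gradient u z \<bullet> b) * \<phi> z \<partial>?L)"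
    by simp
qed

lemma has_trace_smooth:
  assumes "0 < h" "smooth u"
  shows "has_trace (right_triangle h) (hyp_measure h) u u"
proof -
  note c = smooth_continuous[OF assms(2)] continuous_gradient[OF assms(2)]
  have "u \<in> H1 (right_triangle h)"
    using L2_triangle[OF c(1)] L2_triangle[OF c(2)] smooth_has_weak_gradient[OF assms]
    by (auto simp: H1_def)
  then show ?thesis
    unfolding has_trace_def
    using assms smooth_has_weak_gradient[OF assms] L2_triangle[OF c(1)] L2_triangle[OF c(2)] L2_hyp_measure[OF c(1)]
    by (intro conjI exI[of _ "gradient u"] exI[of _ "\<lambda>n. u"] L2_converges_const) auto
qed

text \<open>The Steklov eigenfunction of the triangle, with eigenvalue \<open>1 / h\<close> on the hypotenuse.\<close>

definition saddle :: "real \<times> real \<Rightarrow> real" where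
  "saddle z = fst z * snd z"

lemma smooth_saddle: "smooth saddle"
proof -
  have eq: "saddle = (\<lambda>z. (z \<bullet> (1, 0)) * (z \<bullet> (0, 1)))"
    by (auto simp: saddle_def inner_prod_def)
  show ?thesis unfolding eq by (intro smooth_mult smooth_inner)
qed

lemma gradient_saddle: "gradient saddle z = (snd z, fst z)"
proof -
  have "(saddle has_derivative (\<lambda>y. fst z * snd y + fst y * snd z)) (at z)"
    unfolding saddle_def by (auto intro!: derivative_eq_intros)
  from frechet_derivative_at[OF this, symmetric] show ?thesis
    by (simp add: gradient_real_prod)
qed

lemma saddle_mean: "0 < h \<Longrightarrow> (\<integral>z. saddle z \<partial>hyp_measure h) = 0"
  using integral_symmetrize[OF _ continuous_on_column[OF smooth_continuous[OF smooth_saddle], of UNIV h], of h]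
  by (simp add: integral_hyp_measure smooth_continuous smooth_saddle) (simp add: saddle_def)

lemma saddle_norms:
  assumes h: "0 < h"
  shows "(\<integral>z. (norm (saddle z))\<^sup>2 \<partial>hyp_measure h) = 2 * h ^ 5 / 3"
    and "(\<integral>z. (norm (gradient saddle z))\<^sup>2 \<partial>lebesgue_on (right_triangle h)) = 2 * h ^ 4 / 3"
proof -
  have cube: "((\<lambda>t. t\<^sup>2) has_integral h ^ 3 / 3 - 0 ^ 3 / 3) {0..h}"
    using h by (intro fundamental_theorem_of_calculus)
      (auto intro!: derivative_eq_intros simp: has_real_derivative_iff_has_vector_derivative[symmetric])
  have "(\<integral>z. (norm (saddle z))\<^sup>2 \<partial>hyp_measure h) = integral {-h..h} (\<lambda>t. (saddle (h, t))\<^sup>2)"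
    by (subst integral_hyp_measure) (auto intro!: continuous_intros smooth_continuous[OF smooth_saddle])
  also have "\<dots> = integral {0..h} (\<lambda>t. (2 * h\<^sup>2) * t\<^sup>2)"
    using h by (subst integral_symmetrize)
      (auto simp: saddle_def power_mult_distrib intro!: continuous_intros)
  also have "\<dots> = (2 * h\<^sup>2) * (h ^ 3 / 3)"
    using integral_unique[OF cube] by simp
  finally show "(\<integral>z. (norm (saddle z))\<^sup>2 \<partial>hyp_measure h) = 2 * h ^ 5 / 3"
    by (simp add: eval_nat_numeral)
  let ?L = "lebesgue_on (right_triangle h)"
  have P: "continuous_on UNIV (\<lambda>z::real \<times> real. (snd z)\<^sup>2)" and Q: "continuous_on UNIV (\<lambda>z::real \<times> real. (fst z)\<^sup>2)"
    by (auto intro!: continuous_intros)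
  have "((\<lambda>t. (2 * h) * t\<^sup>2) has_integral (\<integral>z. (snd z)\<^sup>2 \<partial>?L) + (\<integral>z. (fst z)\<^sup>2 \<partial>?L)) {0..h}"
    by (rule has_integral_eq[OF _ has_integral_add[OF triangle_rows[OF h P] triangle_columns[OF h Q]]])
      (auto simp: algebra_simps power2_eq_square)
  moreover have "((\<lambda>t. (2 * h) * t\<^sup>2) has_integral (2 * h) * (h ^ 3 / 3)) {0..h}"
    using has_integral_mult_right[OF cube, of "2 * h"] by simp
  ultimately have "(\<integral>z. (snd z)\<^sup>2 \<partial>?L) + (\<integral>z. (fst z)\<^sup>2 \<partial>?L) = (2 * h) * (h ^ 3 / 3)"
    by (rule has_integral_unique)
  moreover have "(\<integral>z. (norm (gradient saddle z))\<^sup>2 \<partial>?L) = (\<integral>z. (snd z)\<^sup>2 \<partial>?L) + (\<integral>z. (fst z)\<^sup>2 \<partial>?L)"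
    by (simp add: gradient_saddle norm_prod_def integrable_triangle P Q)
  ultimately show "(\<integral>z. (norm (gradient saddle z))\<^sup>2 \<partial>?L) = 2 * h ^ 4 / 3"
    by (simp add: eval_nat_numeral)
qed

theorem theorem3p6:
  fixes h :: real
  assumes "h > 0"
  shows "is_exact_constant_C2 (right_triangle h) (length_on_line h (hypotenuse h)) (h powr (1/2))"
  unfolding is_exact_constant_C2_def powr_half_sqrt[OF less_imp_le[OF assms]]
proof (intro conjI allI impI)
  show "trace_inequality (right_triangle h) (hyp_measure h) (sqrt h)"
    by (rule trace_inequality_hypotenuse[OF assms])
  fix C' assume C': "trace_inequality (right_triangle h) (hyp_measure h) C'"
  let ?L = "lebesgue_on (right_triangle h)"
  note t = has_trace_smooth[OF assms smooth_saddle]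
  have "saddle \<in> H1_tilde (right_triangle h) (hyp_measure h)"
    using t saddle_mean[OF assms] by (auto simp: H1_tilde_def has_trace_def mean_value_def)
  then have "L2_norm (hyp_measure h) saddle \<le> C' * L2_norm ?L (gradient saddle)"
    using C' t smooth_has_weak_gradient[OF assms smooth_saddle]
      L2_triangle[OF continuous_gradient[OF smooth_saddle]]
    by (simp add: trace_inequality_def)
  moreover have "L2_norm (hyp_measure h) saddle = sqrt h * L2_norm ?L (gradient saddle)"
    unfolding L2_norm_def saddle_norms[OF assms]
    by (simp add: eval_nat_numeral mult_ac flip: real_sqrt_mult)
  moreover have "0 < L2_norm ?L (gradient saddle)"
    unfolding L2_norm_def saddle_norms[OF assms] using assms by simp
  ultimately show "sqrt h \<le> C'" by simp
qed

end
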